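(* A word identity $\mathbf{u}\approx\mathbf{v}$ holds in $(\mathsf{baxt}_3,{}^{\sharp})$ if and only if $\mathbf{u}\approx\mathbf{v}$ is balanced and satisfies that for any $x,y\in\mathsf{con}(\mathbf{u})$ with $x,x^*\neq y$, the following hold, where $Z=\{x,x^*,y,y^*\}$: (I) (a) if $\mathbf{u}[x,y]\in x^{\alpha}x^*Z^{\times}$ for some $\alpha\ge1$, then $\mathbf{v}[x,y]\in x^{\alpha}x^*Z^{\times}$; (b) if $\mathbf{u}[x,y]\in Z^{\times}x^*x^{\alpha}$ for some $\alpha\ge1$, then $\mathbf{v}[x,y]\in Z^{\times}x^*x^{\alpha}$. (II) (a) if $\mathbf{u}[x,y]\in y^{\alpha}xZ^{\times}$ for some $\alpha\ge1$, then $\mathbf{v}[x,y]\in y^{\alpha}xZ^{\times}$; (b) if $\mathbf{u}[x,y]\in Z^{\times}xy^{\alpha}$ for some $\alpha\ge1$, then $\mathbf{v}[x,y]\in Z^{\times}xy^{\alpha}$. (III) (a) if $\mathbf{u}[x,y]\in \mathbf{a}xZ^{\times}$ with $\mathsf{con}(\mathbf{a})=\{x^*,y^*\}$, then $\mathbf{v}[x,y]\in\mathbf{a}'xZ^{\times}$ where $\mathbf{a}'$ is a permutation of $\mathbf{a}$; (b) if $\mathbf{u}[x,y]\in Z^{\times}x\mathbf{a}$ with $\mathsf{con}(\mathbf{a})=\{x^*,y^*\}$, then $\mathbf{v}[x,y]\in Z^{\times}x\mathbf{a}'$ where $\mathbf{a}'$ is a permutation of $\mathbf{a}$. (IV) (a)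 $\overleftarrow{\mathsf{occ}}_y(x,\mathbf{u})+\overleftarrow{\mathsf{occ}}_y(x^*,\mathbf{u})=\overleftarrow{\mathsf{occ}}_y(x,\mathbf{v})+\overleftarrow{\mathsf{occ}}_y(x^*,\mathbf{v})$; (b) $\overrightarrow{\mathsf{occ}}_y(x,\mathbf{u})+\overrightarrow{\mathsf{occ}}_y(x^*,\mathbf{u})=\overrightarrow{\mathsf{occ}}_y(x,\mathbf{v})+\overrightarrow{\mathsf{occ}}_y(x^*,\mathbf{v})$. (V) (a) if $\mathbf{u}[x,y]\in\mathbf{a}yZ^{\times}$ with $\mathsf{con}(\mathbf{a})=\{x,x^*\}$, then $\mathbf{v}[x,y]\in\mathbf{a}'yZ^{\times}$ where $\mathbf{a}'$ is a permutation of $\mathbf{a}$; (b) if $\mathbf{u}[x,y]\in Z^{\times}y\mathbf{a}$ with $\mathsf{con}(\mathbf{a})=\{x,x^*\}$, then $\mathbf{v}[x,y]\in Z^{\times}y\mathbf{a}'$ where $\mathbf{a}'$ is a permutation of $\mathbf{a}$.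
   Context: Baxter monoid: for $n\ge 1$ let $\mathcal{A}_n=\{1<2<\cdots<n\}$ and let $\mathcal{A}_n^{\star}$ be the free monoid on $\mathcal{A}_n$. Then $\mathsf{baxt}_n=\mathcal{A}_n^{\star}/\!\equiv$, where $\equiv$ is the congruence generated by all pairs $(c\mathbf{u}ad\mathbf{v}b,\ c\mathbf{u}da\mathbf{v}b)$ with $a\le b<c\le d$ and $(b\mathbf{u}da\mathbf{v}c,\ b\mathbf{u}ad\mathbf{v}c)$ with $a<b\le c<d$, where $a,b,c,d\in\mathcal{A}_n$, $\mathbf{u},\mathbf{v}\in\mathcal{A}_n^{\star}$. Schützenberger's involution $^{\sharp}$ on $\mathsf{baxt}_n$ is induced by $i^{\sharp}=n+1-i$ and $(w_1\cdots w_k)^{\sharp}=w_k^{\sharp}\cdots w_1^{\sharp}$. Words: $\mathcal{X}$ is a countably infinite alphabet, $\mathcal{X}^*=\{x^*:x\in\mathcal{X}\}$ a disjoint copy, with $(x^* )^*=x$; elements of $\mathcal{X}\cup\mathcal{X}^*$ are variables. For a set $Z$ of variables, $Z^{\times}=Z^+\cup\{\emptyset\}$ is the set of all finite words over $Z$, including the empty word $\emptyset$. $\mathsf{con}(\mathbf{u})$ is the set of variables (elements of $\mathcal{X}\cup\mathcal{X}^*$) occurring in $\mathbf{u}$; $\mathsf{occ}(x,\mathbf{u})$ is the number of occurrences of $x$ in $\mathbf{u}$ ($x$ and $x^*$ are counted separately). $\overleftarrow{\mathsf{occ}}_y(x,\mathbf{u})$ (resp. $\overrightarrow{\mathsf{occ}}_y(x,\mathbf{u})$)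 is the number of occurrences of $x$ before the first (resp. after the last) occurrence of $y$ in $\mathbf{u}$. $\mathbf{u}[x,y]$ is the word obtained from $\mathbf{u}$ by retaining only the variables $x,x^*,y,y^*$. A word $\mathbf{a}'$ is a permutation of $\mathbf{a}$ if $\mathsf{occ}(z,\mathbf{a})=\mathsf{occ}(z,\mathbf{a}')$ for every variable $z$. A word identity is an expression $\mathbf{u}\approx\mathbf{v}$ with $\mathbf{u},\mathbf{v}\in(\mathcal{X}\cup\mathcal{X}^* )^+$; it holds in an involution monoid $(M,{}^* )$ if for every map $\varphi:\mathcal{X}\to M$, extended by $\varphi(x^* )=\varphi(x)^*$ and multiplicatively to words, $\varphi(\mathbf{u})=\varphi(\mathbf{v})$. It is balanced if $\mathsf{occ}(x,\mathbf{u})=\mathsf{occ}(x,\mathbf{v})$ for all $x\in\mathsf{con}(\mathbf{u}\mathbf{v})$.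
   Formalization: In (I), y ranges over all variables with x, x* ≠ y, not only those in con(u); as printed the "if" direction fails: x x* ≈ x* x is balanced and meets all conditions vacuously, but x ↦ 1 gives 13 and 31, which are distinct in baxt_3. *)

theory Defs
  imports "HOL-Algebra.Group" "HOL-Library.Infinite_Typeclass" "HOL-Library.Countable"
begin

section \<open>Congruences on a free monoid\<close>

text \<open>The least congruence on the free monoid of words over \<open>A\<close> that contains the pairs in \<open>R\<close>.\<close>

inductive_set gen_congruence :: "'a set \<Rightarrow> ('a list \<times> 'a list) set \<Rightarrow> ('a list \<times> 'a list) set"
  for A :: "'a set" and R :: "('a list \<times> 'a list) set"
where
  base: "(u, v) \<in> R \<Longrightarrow> u \<in> lists A \<Longrightarrow> v \<in> lists A \<Longrightarrow> (u, v) \<in> gen_congruence A R"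
| refl: "u \<in> lists A \<Longrightarrow> (u, u) \<in> gen_congruence A R"
| sym: "(u, v) \<in> gen_congruence A R \<Longrightarrow> (v, u) \<in> gen_congruence A R"
| trans: "(u, v) \<in> gen_congruence A R \<Longrightarrow> (v, w) \<in> gen_congruence A R \<Longrightarrow> (u, w) \<in> gen_congruence A R"
| mult: "(u, v) \<in> gen_congruence A R \<Longrightarrow> (u', v') \<in> gen_congruence A R
    \<Longrightarrow> (u @ u', v @ v') \<in> gen_congruence A R"

lemma gen_congruence_lists:
  assumes "(u, v) \<in> gen_congruence A R"
  shows "u \<in> lists A \<and> v \<in> lists A"
  using assms by induction auto

lemma equiv_gen_congruence: "equiv (lists A) (gen_congruence A R)"
proof (rule equivI)
  show "gen_congruence A R \<subseteq> lists A \<times> lists A"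
    using gen_congruence_lists by (fast intro: SigmaI)
  show "refl_on (lists A) (gen_congruence A R)"
    by (auto intro: refl_onI gen_congruence.refl)
  show "Relation.sym (gen_congruence A R)"
    by (auto intro: symI gen_congruence.sym)
  show "Relation.trans (gen_congruence A R)"
    by (auto intro: transI gen_congruence.trans)
qed


section \<open>The Baxter monoid and Schuetzenberger's involution\<close>

inductive_set baxt_relations :: "nat \<Rightarrow> (nat list \<times> nat list) set" for n :: nat where
  cadb: "\<lbrakk>{a, b, c, d} \<subseteq> {1..n}; u \<in> lists {1..n}; v \<in> lists {1..n}; a \<le> b; b < c; c \<le> d\<rbrakk>
    \<Longrightarrow> ([c] @ u @ [a, d] @ v @ [b], [c] @ u @ [d, a] @ v @ [b]) \<in> baxt_relations n"
| bdac: "\<lbrakk>{a, b, c, d} \<subseteq> {1..n}; u \<in> lists {1..n}; v \<in> lists {1..n}; a < b; b \<le> c; c < d\<rbrakk>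
    \<Longrightarrow> ([b] @ u @ [d, a] @ v @ [c], [b] @ u @ [a, d] @ v @ [c]) \<in> baxt_relations n"

definition baxt_cong :: "nat \<Rightarrow> (nat list \<times> nat list) set" where
  "baxt_cong n = gen_congruence {1..n} (baxt_relations n)"

text \<open>Elements are the congruence classes. The unions below run over a family of equal classes,
  because the operations on words respect the congruence.\<close>

definition baxt :: "nat \<Rightarrow> nat list set monoid" where
  "baxt n = \<lparr> carrier = lists {1..n} // baxt_cong n,
     mult = (\<lambda>P Q. \<Union>p\<in>P. \<Union>q\<in>Q. baxt_cong n `` {p @ q}),
     one = baxt_cong n `` {[]} \<rparr>"

definition word_sharp :: "nat \<Rightarrow> nat list \<Rightarrow> nat list" where
  "word_sharp n w = rev (map (\<lambda>i. n + 1 - i) w)"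

definition sharp :: "nat \<Rightarrow> nat list set \<Rightarrow> nat list set" where
  "sharp n P = (\<Union>p\<in>P. baxt_cong n `` {word_sharp n p})"

lemma equiv_baxt_cong: "equiv (lists {1..n}) (baxt_cong n)"
  unfolding baxt_cong_def by (rule equiv_gen_congruence)

lemma baxt_mult_class:
  assumes "u \<in> lists {1..n}" and "v \<in> lists {1..n}"
  shows "(baxt_cong n `` {u}) \<otimes>\<^bsub>baxt n\<^esub> (baxt_cong n `` {v}) = baxt_cong n `` {u @ v}"
proof -
  have "congruent2 (baxt_cong n) (baxt_cong n) (\<lambda>p q. baxt_cong n `` {p @ q})"
  proof (rule congruent2I')
    fix p q p' q' assume "(p, p') \<in> baxt_cong n" and "(q, q') \<in> baxt_cong n"
    then have "(p @ q, p' @ q') \<in> baxt_cong n"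
      unfolding baxt_cong_def by (rule gen_congruence.mult)
    then show "baxt_cong n `` {p @ q} = baxt_cong n `` {p' @ q'}"
      by (rule equiv_class_eq[OF equiv_baxt_cong])
  qed
  then show ?thesis
    unfolding baxt_def monoid.simps
    by (rule UN_equiv_class2[OF equiv_baxt_cong equiv_baxt_cong _ assms])
qed

lemma baxt_carrierI: "p \<in> lists {1..n} \<Longrightarrow> baxt_cong n `` {p} \<in> carrier (baxt n)"
  unfolding baxt_def by (simp only: partial_object.simps quotientI)

lemma baxt_carrierE:
  assumes "P \<in> carrier (baxt n)"
  obtains p where "p \<in> lists {1..n}" and "P = baxt_cong n `` {p}"
proof -
  have "P \<in> lists {1..n} // baxt_cong n" using assms by (simp only: baxt_def partial_object.simps)
  then show thesis by (rule quotientE) (rule that)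
qed

lemma baxt_monoid: "monoid (baxt n)"
proof (rule monoidI)
  have one: "\<one>\<^bsub>baxt n\<^esub> = baxt_cong n `` {[]}" by (simp add: baxt_def)
  show "\<one>\<^bsub>baxt n\<^esub> \<in> carrier (baxt n)"
    unfolding one by (rule baxt_carrierI) simp
  fix x assume "x \<in> carrier (baxt n)"
  then obtain p where p: "p \<in> lists {1..n}" "x = baxt_cong n `` {p}" by (rule baxt_carrierE)
  show "\<one>\<^bsub>baxt n\<^esub> \<otimes>\<^bsub>baxt n\<^esub> x = x" "x \<otimes>\<^bsub>baxt n\<^esub> \<one>\<^bsub>baxt n\<^esub> = x"
    using p baxt_mult_class[of "[]" n p] baxt_mult_class[of p n "[]"] by (simp_all add: one)
  fix y assume "y \<in> carrier (baxt n)"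
  then obtain q where q: "q \<in> lists {1..n}" "y = baxt_cong n `` {q}" by (rule baxt_carrierE)
  have pq: "p @ q \<in> lists {1..n}" using p q by simp
  show "x \<otimes>\<^bsub>baxt n\<^esub> y \<in> carrier (baxt n)"
    using baxt_carrierI[OF pq] by (simp only: p q baxt_mult_class)
  fix z assume "z \<in> carrier (baxt n)"
  then obtain r where r: "r \<in> lists {1..n}" "z = baxt_cong n `` {r}" by (rule baxt_carrierE)
  have qr: "q @ r \<in> lists {1..n}" using q r by simp
  show "x \<otimes>\<^bsub>baxt n\<^esub> y \<otimes>\<^bsub>baxt n\<^esub> z = x \<otimes>\<^bsub>baxt n\<^esub> (y \<otimes>\<^bsub>baxt n\<^esub> z)"
    using p(1) q(1) r(1) pq qr by (simp only: p(2) q(2) r(2) baxt_mult_class append_assoc)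
qed

lemma word_sharp_lists: "w \<in> lists {1..n} \<Longrightarrow> word_sharp n w \<in> lists {1..n}"
  unfolding word_sharp_def by (auto simp: in_lists_conv_set)

lemma word_sharp_append: "word_sharp n (u @ v) = word_sharp n v @ word_sharp n u"
  by (simp add: word_sharp_def)

lemma word_sharp_word_sharp: "w \<in> lists {1..n} \<Longrightarrow> word_sharp n (word_sharp n w) = w"
  unfolding word_sharp_def by (induction w) (auto simp: rev_map)

lemma word_sharp_relations:
  assumes "(u, v) \<in> baxt_relations n"
  shows "(word_sharp n u, word_sharp n v) \<in> baxt_relations n"
  using assms
proof cases
  let ?s = "\<lambda>i. n + 1 - i"
  case (cadb a b c d p q)
  have "{?s d, ?s c, ?s b, ?s a} \<subseteq> {1..n}" "?s d \<le> ?s c" "?s c < ?s b" "?s b \<le> ?s a"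
    using cadb by auto
  from baxt_relations.cadb[OF this(1) word_sharp_lists[OF cadb(5)] word_sharp_lists[OF cadb(4)] this(2-4)]
  show ?thesis by (simp add: cadb(1,2) word_sharp_def)
next
  let ?s = "\<lambda>i. n + 1 - i"
  case (bdac a b c d p q)
  have "{?s d, ?s c, ?s b, ?s a} \<subseteq> {1..n}" "?s d < ?s c" "?s c \<le> ?s b" "?s b < ?s a"
    using bdac by auto
  from baxt_relations.bdac[OF this(1) word_sharp_lists[OF bdac(5)] word_sharp_lists[OF bdac(4)] this(2-4)]
  show ?thesis by (simp add: bdac(1,2) word_sharp_def)
qed

lemma word_sharp_cong:
  assumes "(u, v) \<in> baxt_cong n"
  shows "(word_sharp n u, word_sharp n v) \<in> baxt_cong n"
  using assms unfolding baxt_cong_def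
proof induction
  case (base u v)
  then show ?case by (intro gen_congruence.base word_sharp_relations word_sharp_lists)
next
  case (refl u)
  then show ?case by (intro gen_congruence.refl word_sharp_lists)
next
  case (sym u v)
  show ?case using sym.IH by (rule gen_congruence.sym)
next
  case (trans u v w)
  show ?case using trans.IH by (rule gen_congruence.trans)
next
  case (mult u v u' v')
  then show ?case by (simp only: word_sharp_append gen_congruence.mult)
qed

lemma sharp_class:
  assumes "u \<in> lists {1..n}"
  shows "sharp n (baxt_cong n `` {u}) = baxt_cong n `` {word_sharp n u}"
proof -
  have "congruent (baxt_cong n) (\<lambda>p. baxt_cong n `` {word_sharp n p})"
    by (rule congruentI) (rule equiv_class_eq[OF equiv_baxt_cong word_sharp_cong])
  then show ?thesis
    unfolding sharp_def by (rule UN_equiv_class[OF equiv_baxt_cong _ assms])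
qed

lemma sharp_involution:
  assumes "P \<in> carrier (baxt n)" and "Q \<in> carrier (baxt n)"
  shows "sharp n P \<in> carrier (baxt n)"
    and "sharp n (sharp n P) = P"
    and "sharp n (P \<otimes>\<^bsub>baxt n\<^esub> Q) = sharp n Q \<otimes>\<^bsub>baxt n\<^esub> sharp n P"
proof -
  obtain p where p: "p \<in> lists {1..n}" "P = baxt_cong n `` {p}"
    using assms(1) by (rule baxt_carrierE)
  obtain q where q: "q \<in> lists {1..n}" "Q = baxt_cong n `` {q}"
    using assms(2) by (rule baxt_carrierE)
  have pq: "p @ q \<in> lists {1..n}" using p q by simp
  note w = word_sharp_lists[OF p(1)] word_sharp_lists[OF q(1)]
  show "sharp n P \<in> carrier (baxt n)"
    using baxt_carrierI[OF w(1)] p(1) by (simp only: p(2) sharp_class)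
  show "sharp n (sharp n P) = P"
    using p(1) w(1) by (simp only: p(2) sharp_class word_sharp_word_sharp)
  show "sharp n (P \<otimes>\<^bsub>baxt n\<^esub> Q) = sharp n Q \<otimes>\<^bsub>baxt n\<^esub> sharp n P"
    using p(1) q(1) pq w by (simp only: p(2) q(2) sharp_class baxt_mult_class word_sharp_append)
qed


section \<open>Words with involution and word identities\<close>

text \<open>The variables: a letter of \<open>'x\<close>, or its formal star.\<close>

datatype 'x variable = Plain 'x | Starred 'x

primrec star :: "'x variable \<Rightarrow> 'x variable" where
  "star (Plain x) = Starred x"
| "star (Starred x) = Plain x"

primrec eval_var :: "('a \<Rightarrow> 'a) \<Rightarrow> ('x \<Rightarrow> 'a) \<Rightarrow> 'x variable \<Rightarrow> 'a" where
  "eval_var inv_op \<phi> (Plain x) = \<phi> x"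
| "eval_var inv_op \<phi> (Starred x) = inv_op (\<phi> x)"

primrec eval_word :: "('a, 'b) monoid_scheme \<Rightarrow> ('a \<Rightarrow> 'a) \<Rightarrow> ('x \<Rightarrow> 'a) \<Rightarrow> 'x variable list \<Rightarrow> 'a" where
  "eval_word M inv_op \<phi> [] = \<one>\<^bsub>M\<^esub>"
| "eval_word M inv_op \<phi> (z # w) = eval_var inv_op \<phi> z \<otimes>\<^bsub>M\<^esub> eval_word M inv_op \<phi> w"

definition identity_holds ::
  "('a, 'b) monoid_scheme \<Rightarrow> ('a \<Rightarrow> 'a) \<Rightarrow> 'x variable list \<Rightarrow> 'x variable list \<Rightarrow> bool" where
  "identity_holds M inv_op u v \<longleftrightarrow>
     (\<forall>\<phi> \<in> UNIV \<rightarrow> carrier M. eval_word M inv_op \<phi> u = eval_word M inv_op \<phi> v)"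

abbreviation con :: "'x variable list \<Rightarrow> 'x variable set" where
  "con u \<equiv> set u"

abbreviation occ :: "'x variable \<Rightarrow> 'x variable list \<Rightarrow> nat" where
  "occ x u \<equiv> count_list u x"

definition balanced :: "'x variable list \<Rightarrow> 'x variable list \<Rightarrow> bool" where
  "balanced u v \<longleftrightarrow> (\<forall>x \<in> con (u @ v). occ x u = occ x v)"

definition permutation_of :: "'x variable list \<Rightarrow> 'x variable list \<Rightarrow> bool" where
  "permutation_of a' a \<longleftrightarrow> (\<forall>z. occ z a = occ z a')"

text \<open>Only used for \<open>y\<close> occurring in \<open>u\<close>; otherwise both count all occurrences of \<open>x\<close>.\<close>

definition occ_before_first :: "'x variable \<Rightarrow> 'x variable \<Rightarrow> 'x variable list \<Rightarrow> nat" where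
  "occ_before_first y x u = occ x (takeWhile (\<lambda>z. z \<noteq> y) u)"

definition occ_after_last :: "'x variable \<Rightarrow> 'x variable \<Rightarrow> 'x variable list \<Rightarrow> nat" where
  "occ_after_last y x u = occ x (takeWhile (\<lambda>z. z \<noteq> y) (rev u))"

definition var_pair :: "'x variable \<Rightarrow> 'x variable \<Rightarrow> 'x variable set" where
  "var_pair x y = {x, star x, y, star y}"

definition retain :: "'x variable list \<Rightarrow> 'x variable \<Rightarrow> 'x variable \<Rightarrow> 'x variable list" where
  "retain u x y = filter (\<lambda>z. z \<in> var_pair x y) u"

definition conc :: "'a list set \<Rightarrow> 'a list set \<Rightarrow> 'a list set"  (infixr "\<cdot>" 75) where
  "K \<cdot> L = {k @ l | k l. k \<in> K \<and> l \<in> L}"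

section \<open>The range of \<open>y\<close> in condition (I)\<close>

text \<open>If \<open>y\<close> ranges over \<open>con u\<close> only, conditions (I)--(V) do not suffice. Write \<open>z*\<close> for \<open>star z\<close>.
  For \<open>u = y* y x x* x x* x\<close> and \<open>v = y* y x x x* x* x\<close> they all hold, but the identity fails, as
  \<open>x \<mapsto> 1\<close>, \<open>y \<mapsto> empty word\<close> shows. For \<open>x x*\<close> and \<open>x* x\<close> there is no admissible \<open>y\<close> at all.
  What is missing is (I) for the words obtained from \<open>u\<close> and \<open>v\<close> by retaining \<open>x\<close>, \<open>x*\<close> alone.
  Hence in (I), \<open>y\<close> is allowed to be any variable with \<open>x, x* \<noteq> y\<close>: if neither \<open>y\<close> nor \<open>y*\<close>
  occurs, then \<open>retain u x y\<close> is that word. In (II)--(V), \<open>y\<close> ranges over \<open>con u\<close>.\<close>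

lemma baxt_cong_leading_ones:
  assumes "(p, q) \<in> baxt_cong n"
  shows "takeWhile (\<lambda>i. i = 1) p = takeWhile (\<lambda>i. i = 1) q \<and> ((\<forall>i\<in>set p. i = 1) \<longleftrightarrow> (\<forall>i\<in>set q. i = 1))"
  using assms unfolding baxt_cong_def
proof induction
  case (base p q)
  from base(1) show ?case by cases auto
next
  case (mult p q p' q')
  show ?case
  proof (cases "\<forall>i\<in>set p. i = 1")
    case True
    then have "p = q"
      using mult.IH(1) takeWhile_eq_all_conv[of "\<lambda>i. i = 1" p] takeWhile_eq_all_conv[of "\<lambda>i. i = 1" q]
      by metis
    then show ?thesis using True mult.IH(2) by (simp add: takeWhile_append ball_Un)
  next
    case False
    then have "\<not> (\<forall>i\<in>set q. i = 1)" using mult.IH(1) by blast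
    with False show ?thesis using mult.IH(1) by (simp only: takeWhile_append set_append ball_Un if_False simp_thms)
  qed
qed simp_all

lemma not_identity_starred_swap:
  assumes "x \<noteq> y"
  shows "\<not> identity_holds (baxt 3) (sharp 3)
    [Starred y, Plain y, Plain x, Starred x, Plain x, Starred x, Plain x]
    [Starred y, Plain y, Plain x, Plain x, Starred x, Starred x, Plain x]"
proof
  let ?c = "\<lambda>w. baxt_cong 3 `` {w}"
  let ?\<phi> = "\<lambda>z. if z = x then ?c [1] else ?c []"
  assume *: "identity_holds (baxt 3) (sharp 3)
    [Starred y, Plain y, Plain x, Starred x, Plain x, Starred x, Plain x]
    [Starred y, Plain y, Plain x, Plain x, Starred x, Starred x, Plain x]"
  have "?\<phi> \<in> UNIV \<rightarrow> carrier (baxt 3)"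
    by (auto simp: baxt_def intro!: quotientI)
  note eq = bspec[OF *[unfolded identity_holds_def] this]
  have one: "\<one>\<^bsub>baxt 3\<^esub> = ?c []" by (simp add: baxt_def)
  have mem: "[] \<in> lists {1..3::nat}" "[1] \<in> lists {1..3::nat}" "[3] \<in> lists {1..3::nat}"
    by auto
  have "sharp 3 (?c []) = ?c []" "sharp 3 (?c [1]) = ?c [3]"
    using sharp_class[OF mem(1)] sharp_class[OF mem(2)] by (simp_all add: word_sharp_def)
  moreover have "?c [i] \<otimes>\<^bsub>baxt 3\<^esub> ?c w = ?c (i # w)" if "i \<in> {1..3}" "w \<in> lists {1..3}" for i w
    using baxt_mult_class[of "[i]" 3 w] that by simp
  moreover have "?c [] \<otimes>\<^bsub>baxt 3\<^esub> ?c w = ?c w" if "w \<in> lists {1..3}" for w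
    using baxt_mult_class[OF mem(1) that] by simp
  ultimately have "?c [1, 3, 1, 3, 1] = ?c [1, 1, 3, 3, 1]"
    using eq assms[symmetric] by (simp add: one)
  then have "([1, 3, 1, 3, 1], [1, 1, 3, 3, 1]) \<in> baxt_cong 3"
    using eq_equiv_class[OF _ equiv_baxt_cong, of 3 "[1, 3, 1, 3, 1]" "[1, 1, 3, 3, 1]"] by simp
  from baxt_cong_leading_ones[OF this] show False by simp
qed

end

(* Two words over {1,2,3} are Baxter-congruent iff they have the same content and agree in the
   number of 1s before the first letter >= 2, of 1s before the first 2, of 2s before the first 3,
   and in the mirror images of these numbers under the involution.

   For the value of a word u under an assignment, such a number only depends on the first variable
   b of u whose word contains one of the stopping letters, and on the number of occurrences of each
   variable z before b; often only occ z + occ (star z) matters, because 2 is fixed by the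
   involution. By conditions (I)-(III), u and v have the same such b; by (I), (II), (IV) and (V)
   the relevant numbers of occurrences agree. Conversely, each condition is read off from a few
   assignments that send x and y to words of length at most 3 and all other letters to the empty
   word. *)
theory Submission
  imports Defs "HOL-Library.Multiset"
begin

section \<open>The Baxter congruence on three letters\<close>

text \<open>The six numbers come from the exchanges that the relations allow. Adjacent 1 and 3
  commute once a letter of {2, 3} stands to the left and one of {1, 2} to the right; 1 and 2 need a
  2 to the left and a 1 to the right; 2 and 3 need a 3 to the left and a 2 to the right. Each number
  measures one side on which such an exchange is blocked. The obstacle is the transfer of counts
  from \<open>u\<close> to \<open>v\<close>: condition (IV) fixes only the sum of the occurrences of
  \<open>z\<close> and \<open>star z\<close> before \<open>b\<close>. Each left number gets around
  this differently. A word without 2 and 3 is a power of 1, so its image under the involution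
  contributes no 1. The stopping letter 2 is its own image, so the stopping variables are closed
  under \<open>star\<close> and exact counts are available. The number of 2s is invariant under the
  involution.\<close>

definition count_before :: "nat \<Rightarrow> nat set \<Rightarrow> nat list \<Rightarrow> nat" where
  "count_before c S w = count_list (takeWhile (\<lambda>i. i \<notin> S) w) c"

text \<open>Together with the content and with the data of the image under \<open>word_sharp 3\<close>, these three numbers
  are a complete set of invariants of the Baxter congruence on three letters. If no letter of the
  set occurs, \<open>count_before\<close> counts the whole word; this value is then determined by the content.\<close>

definition left_data :: "nat list \<Rightarrow> nat \<times> nat \<times> nat" where
  "left_data w = (count_before 1 {2, 3} w, count_before 1 {2} w, count_before 2 {3} w)"

lemma count_before_simps [simp]:
  "count_before c S [] = 0"
  "count_before c S (i # w) = (if i \<in> S then 0 else (if i = c then 1 else 0) + count_before c S w)"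
  by (auto simp: count_before_def)

lemma count_before_append:
  "count_before c S (p @ w) =
     (if set p \<inter> S = {} then count_list p c + count_before c S w else count_before c S p)"
  by (induction p) auto

lemma count_before_le: "count_before c S w \<le> count_list w c"
  by (induction w) auto

lemma mset_eq_iff_count_list: "mset p = mset q \<longleftrightarrow> (\<forall>x. count_list p x = count_list q x)"
  by (simp add: multiset_eq_iff count_mset)

lemma letter_cases: "i = 1 \<or> i = 2 \<or> i = 3" if "i \<in> {1..3}" for i :: nat
  using that by auto

text \<open>A counter notices the exchange of two adjacent letters only if one of them is counted
  and the other stops it. In each such case the letter in front, \<open>c\<close> or
  \<open>b\<close>, has stopped it already.\<close>

lemma baxt_relations_left_data:
  assumes "(p, q) \<in> baxt_relations 3"
  shows "mset p = mset q" and "left_data p = left_data q"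
proof -
  show "mset p = mset q"
    using assms by cases auto
  show "left_data p = left_data q"
    using assms
  proof cases
    case (cadb a b c d u v)
    then have "a = 1 \<or> a = 2 \<or> a = 3" "b = 1 \<or> b = 2 \<or> b = 3" "c = 1 \<or> c = 2 \<or> c = 3" "d = 1 \<or> d = 2 \<or> d = 3"
      using letter_cases by auto
    with cadb show ?thesis
      by (elim disjE) (auto simp: left_data_def count_before_append)
  next
    case (bdac a b c d u v)
    then have "a = 1" "b = 2" "c = 2" "d = 3" by auto
    with bdac show ?thesis
      by (auto simp: left_data_def count_before_append)
  qed
qed

text \<open>Content and data go through the induction together: the data of a product depend on
  which letters occur in the left factor and how often.\<close>

lemma baxt_cong_left_data:
  assumes "(p, q) \<in> baxt_cong 3"
  shows "mset p = mset q \<and> left_data p = left_data q"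
  using assms unfolding baxt_cong_def
proof induction
  case (base p q)
  then show ?case using baxt_relations_left_data by blast
next
  case (mult p q p' q')
  then have "set p = set q" "\<And>c. count_list p c = count_list q c"
    using mset_eq_setD mset_eq_iff_count_list by blast+
  then show ?case
    using mult by (auto simp: left_data_def count_before_append)
qed simp_all

section \<open>Exchanging and moving letters within a congruence class\<close>

lemma baxt_cong_refl: "p \<in> lists {1..n} \<Longrightarrow> (p, p) \<in> baxt_cong n"
  unfolding baxt_cong_def by (rule gen_congruence.refl)

lemma baxt_cong_sym: "(p, q) \<in> baxt_cong n \<Longrightarrow> (q, p) \<in> baxt_cong n"
  unfolding baxt_cong_def by (rule gen_congruence.sym)

lemma baxt_cong_trans:
  "(p, q) \<in> baxt_cong n \<Longrightarrow> (q, r) \<in> baxt_cong n \<Longrightarrow> (p, r) \<in> baxt_cong n"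
  unfolding baxt_cong_def by (rule gen_congruence.trans)

lemma baxt_cong_context:
  assumes "(u, v) \<in> baxt_cong n" and "p \<in> lists {1..n}" and "q \<in> lists {1..n}"
  shows "(p @ u @ q, p @ v @ q) \<in> baxt_cong n"
  using assms unfolding baxt_cong_def by (intro gen_congruence.mult gen_congruence.refl)

lemma baxt_cong_lists:
  "(p, q) \<in> baxt_cong n \<Longrightarrow> p \<in> lists {1..n} \<and> q \<in> lists {1..n}"
  unfolding baxt_cong_def by (rule gen_congruence_lists)

text \<open>A letter \<open>l\<close> to the left and a letter \<open>r\<close> to the right of adjacent letters \<open>a < d\<close> allow
  exchanging \<open>a\<close> and \<open>d\<close>, by one of the two defining relations.\<close>

definition separates :: "nat \<Rightarrow> nat \<Rightarrow> nat \<Rightarrow> nat \<Rightarrow> bool" where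
  "separates a d l r \<longleftrightarrow> a < d \<and> (a \<le> r \<and> r < l \<and> l \<le> d \<or> a < l \<and> l \<le> r \<and> r < d)"

lemma baxt_cong_swap:
  assumes "separates a d l r" and "l \<in> set p" and "r \<in> set q"
    and "p \<in> lists {1..n}" and "q \<in> lists {1..n}" and "a \<in> {1..n}" and "d \<in> {1..n}"
  shows "(p @ a # d # q, p @ d # a # q) \<in> baxt_cong n"
proof -
  obtain p1 p2 where p: "p = p1 @ l # p2" using assms(2) by (meson split_list)
  obtain q1 q2 where q: "q = q1 @ r # q2" using assms(3) by (meson split_list)
  have mem: "{a, d, l, r} \<subseteq> {1..n}" "p1 \<in> lists {1..n}" "p2 \<in> lists {1..n}"
    "q1 \<in> lists {1..n}" "q2 \<in> lists {1..n}"
    using assms p q by auto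
  have "([l] @ p2 @ [a, d] @ q1 @ [r], [l] @ p2 @ [d, a] @ q1 @ [r]) \<in> baxt_cong n"
  proof (cases "a \<le> r \<and> r < l \<and> l \<le> d")
    case True
    then show ?thesis
      unfolding baxt_cong_def using mem
      by (intro gen_congruence.base baxt_relations.cadb) auto
  next
    case False
    then have *: "a < l" "l \<le> r" "r < d"
      using assms(1) by (auto simp: separates_def)
    have "([l] @ p2 @ [d, a] @ q1 @ [r], [l] @ p2 @ [a, d] @ q1 @ [r]) \<in> baxt_cong n"
      unfolding baxt_cong_def using mem *
      by (intro gen_congruence.base baxt_relations.bdac) auto
    then show ?thesis by (rule baxt_cong_sym)
  qed
  from baxt_cong_context[OF this mem(2) mem(5)] show ?thesis
    by (simp add: p q)
qed

text \<open>The letter \<open>d\<close> passes the letters of \<open>w\<close> from right to left.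
  The separating letters lie in \<open>p\<close> and \<open>q\<close>, outside the moving zone, so
  they stay available throughout; \<open>min\<close> and \<open>max\<close> cover both orders of
  \<open>d\<close> and the letter passed.\<close>

lemma baxt_cong_move_front:
  assumes "\<And>z. z \<in> set w \<Longrightarrow> \<exists>l\<in>set p. \<exists>r\<in>set q. separates (min z d) (max z d) l r"
    and "p \<in> lists {1..n}" and "q \<in> lists {1..n}" and "w \<in> lists {1..n}" and "d \<in> {1..n}"
  shows "(p @ w @ d # q, p @ d # w @ q) \<in> baxt_cong n"
  using assms
proof (induction w arbitrary: q rule: rev_induct)
  case Nil
  then show ?case using baxt_cong_refl[of "p @ d # q" n] by simp
next
  case (snoc z w)
  obtain l r where lr: "l \<in> set p" "r \<in> set q" "separates (min z d) (max z d) l r"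
    using snoc.prems(1)[of z] by auto
  have mem: "p @ w \<in> lists {1..n}" "z \<in> {1..n}"
    using snoc.prems by auto
  have "(p @ w @ z # d # q, p @ w @ d # z # q) \<in> baxt_cong n"
  proof (cases "z < d")
    case True
    then show ?thesis
      using baxt_cong_swap[of z d l r "p @ w" q n] lr mem snoc.prems by simp
  next
    case False
    then have "separates d z l r" using lr(3) by (simp add: min_def max_def split: if_splits)
    then show ?thesis
      using baxt_cong_sym[OF baxt_cong_swap[of d z l r "p @ w" q n]] lr mem snoc.prems by simp
  qed
  moreover have "(p @ w @ d # z # q, p @ d # w @ z # q) \<in> baxt_cong n"
    using snoc.prems by (intro snoc.IH) fastforce+
  ultimately show ?case
    using baxt_cong_trans by fastforce
qed

text \<open>\<open>left_data\<close> of the image under \<open>word_sharp 3\<close>, where \<open>i\<close> becomes \<open>4 - i\<close>.\<close>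

definition right_data :: "nat list \<Rightarrow> nat \<times> nat \<times> nat" where
  "right_data w =
     (count_before 3 {2, 1} (rev w), count_before 3 {2} (rev w), count_before 2 {1} (rev w))"

lemma count_before_map_inj:
  assumes "inj_on f (insert c (S \<union> set w))"
  shows "count_before (f c) (f ` S) (map f w) = count_before c S w"
  using assms by (induction w) (auto simp: inj_on_def)

lemma left_data_word_sharp:
  assumes "w \<in> lists {1..3}"
  shows "left_data (word_sharp 3 w) = right_data w"
proof -
  \<comment> \<open>Subtraction on naturals is truncated, so sending \<open>i\<close> to
    \<open>4 - i\<close> is injective only on numbers up to 4.\<close>
  have inj: "inj_on (\<lambda>i. 4 - i) (insert c (S \<union> set (rev w)))" if "c \<le> 4" "S \<subseteq> {..4}" for c :: nat and S
  proof -
    have "x \<le> 4" if "x \<in> insert c (S \<union> set (rev w))" for x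
      using that assms \<open>c \<le> 4\<close> \<open>S \<subseteq> {..4}\<close> by (auto dest!: subsetD[of "set w"] simp: lists_eq_set)
    then show ?thesis by (intro inj_onI) (metis diff_diff_cancel)
  qed
  have "word_sharp 3 w = map (\<lambda>i. 4 - i) (rev w)"
    by (simp add: word_sharp_def rev_map)
  then show ?thesis
    using count_before_map_inj[OF inj[of 3 "{2, 1}"]] count_before_map_inj[OF inj[of 3 "{2}"]]
      count_before_map_inj[OF inj[of 2 "{1}"]]
    by (simp add: left_data_def right_data_def)
qed

section \<open>Completeness of the data\<close>

lemma baxt_cong_move_three:
  assumes "p \<in> lists {1..3}" and "u \<in> lists {1..3}" and "v \<in> lists {1..3}"
    and "u = x # u'" and "x \<noteq> 3" and "v = 3 # v'" and "mset u = mset v"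
    and "left_data (p @ u) = left_data (p @ v)" and "right_data (p @ u) = right_data (p @ v)"
  obtains w where "(p @ u, p @ 3 # w) \<in> baxt_cong 3"
proof -
  have "3 \<in> set u" using assms by (metis list.set_intros(1) mset_eq_setD)
  then obtain u1 u2 where u: "u = u1 @ 3 # u2" "3 \<notin> set u1" by (meson split_list_first)
  with assms have u1: "u1 \<noteq> []" "x \<in> set u1" by (auto simp: append_eq_Cons_conv)
  have u1_sub: "set u1 \<subseteq> {1, 2}"
  proof
    fix z assume "z \<in> set u1"
    then have "z \<in> {1..3}" "z \<noteq> 3" using u assms(2) by auto
    then show "z \<in> {1, 2}" by auto
  qed
  have cnt: "count_list u i = count_list v i" for i
    using assms(7) by (simp add: mset_eq_iff_count_list)
  have sets: "set u = set v" using assms(7) by (rule mset_eq_setD)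
  have c3: "count_list v' 3 = count_list u2 3"
    using cnt[of 3] u assms(6) by simp
  \<comment> \<open>The 3 has to pass letters 1 and 2. If a 2 is among them, a 3 on the left and a 2
    on the right serve for both letters; if all are 1, any of {2, 3} on the left and any of {1, 2}
    on the right is enough.\<close>
  have "\<exists>l\<in>set p. \<exists>r\<in>set u2. separates (min z 3) (max z 3) l r" if z: "z \<in> set u1" for z
  proof (cases "2 \<in> set u1")
    case True
    \<comment> \<open>Otherwise the counter of 2s would stop at the head of \<open>v\<close> but run
      through \<open>u1\<close>, which contains a 2.\<close>
    have "3 \<in> set p"
    proof (rule ccontr)
      assume "3 \<notin> set p"
      then have "count_list u1 2 = 0"
        using assms(8) u by (simp add: left_data_def count_before_append assms(6))
      with True show False by (simp add: count_list_0_iff)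
    qed
    \<comment> \<open>Otherwise, read from the right, the counter of 3s in \<open>u\<close> would
      include the 3 to be moved and so exceed the number of 3s in \<open>u2\<close>. In
      \<open>v\<close> it stops within \<open>v'\<close>, which has only as many 3s as
      \<open>u2\<close>.\<close>
    moreover have "2 \<in> set u2"
    proof (rule ccontr)
      assume *: "2 \<notin> set u2"
      have "2 \<in> set v" using True u(1) by (simp add: sets[symmetric])
      then have "2 \<in> set v'" using assms(6) by simp
      then have "count_before 3 {2} (rev (p @ v)) \<le> count_list v' 3"
        using count_before_le[of 3 "{2}" "rev v'"] by (simp add: count_before_append assms(6))
      moreover have "count_before 3 {2} (rev (p @ u)) \<ge> count_list u2 3 + 1"
        using * u by (simp add: count_before_append)
      ultimately show False using assms(9) c3 by (simp add: right_data_def)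
    qed
    moreover have "separates (min z 3) (max z 3) 3 2"
      using z u1_sub by (auto simp: separates_def)
    ultimately show ?thesis by blast
  next
    case False
    then have ones: "set u1 \<subseteq> {1}" using u1_sub by auto
    have "\<exists>l\<in>set p. l \<in> {2, 3}"
    proof (rule ccontr)
      assume "\<not> ?thesis"
      then have "set p \<inter> {2, 3} = {}" by auto
      moreover have "set u1 \<inter> {2, 3} = {}" using ones by auto
      ultimately have "count_list u1 1 = 0"
        using assms(8) u by (simp add: left_data_def count_before_append assms(6))
      then have "1 \<notin> set u1" by (simp add: count_list_0_iff)
      with ones u1 show False by auto
    qed
    then obtain l where l: "l \<in> set p" "l \<in> {2, 3}" by blast
    have "\<exists>r\<in>set u2. r \<in> {2, 1}"
    proof (rule ccontr)
      assume *: "\<not> ?thesis"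
      have "1 \<in> set v" using ones u1 u(1) by (auto simp: sets[symmetric])
      then have "1 \<in> set v'" using assms(6) by simp
      then have "count_before 3 {2, 1} (rev (p @ v)) \<le> count_list v' 3"
        using count_before_le[of 3 "{2, 1}" "rev v'"] by (auto simp: count_before_append assms(6))
      moreover have "set u2 \<inter> {2, 1} = {}" using * by auto
      then have "count_before 3 {2, 1} (rev (p @ u)) \<ge> count_list u2 3 + 1"
        using u by (simp add: count_before_append)
      ultimately show False using assms(9) c3 by (simp add: right_data_def)
    qed
    then obtain r where r: "r \<in> set u2" "r \<in> {2, 1}" by blast
    have "z = 1" using z ones by auto
    with l r have "separates (min z 3) (max z 3) l r" by (auto simp: separates_def)
    with l(1) r(1) show ?thesis by blast
  qed
  moreover have "u1 \<in> lists {1..3}" "u2 \<in> lists {1..3}"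
    using assms(2) u(1) by auto
  ultimately have "(p @ u1 @ 3 # u2, p @ 3 # u1 @ u2) \<in> baxt_cong 3"
    using baxt_cong_move_front[of u1 p u2 3 3] assms(1) by simp
  with that show thesis unfolding u(1) .
qed

text \<open>The 1 passes letters 2 and 3, for which a 2 on the left and a 1 on the right suffice.
  Without a 2 in \<open>p\<close>, the leading 1 of \<open>u\<close> would be counted while the
  leading 2 of \<open>v\<close> stops the counter at once. Without a further 1 behind the moved one,
  all 2s of \<open>u\<close> would follow its last 1, whereas the leading 2 of \<open>v\<close>
  precedes its last 1.\<close>

lemma baxt_cong_move_one:
  assumes "p \<in> lists {1..3}" and "u \<in> lists {1..3}" and "v \<in> lists {1..3}"
    and "u = 1 # u'" and "v = 2 # v'" and "mset u = mset v"
    and "left_data (p @ u) = left_data (p @ v)" and "right_data (p @ u) = right_data (p @ v)"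
  obtains w where "(p @ v, p @ 1 # w) \<in> baxt_cong 3"
proof -
  have cnt: "count_list u i = count_list v i" for i
    using assms(6) by (simp add: mset_eq_iff_count_list)
  have "1 \<in> set v" using assms by (metis list.set_intros(1) mset_eq_setD)
  then obtain v1 v2 where v: "v = v1 @ 1 # v2" "1 \<notin> set v1" by (meson split_list_first)
  with assms obtain v3 where v3: "v1 = 2 # v3" by (auto simp: append_eq_Cons_conv)
  have "2 \<in> set p"
  proof (rule ccontr)
    assume "2 \<notin> set p"
    then show False
      using assms(7) by (simp add: left_data_def count_before_append assms(4,5))
  qed
  moreover have "1 \<in> set v2"
  proof (rule ccontr)
    assume *: "1 \<notin> set v2"
    then have "count_list u 1 = 1" using cnt[of 1] v by simp
    then have "1 \<notin> set u'" using assms(4) by (simp add: count_list_0_iff)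
    then have "count_before 2 {1} (rev (p @ u)) = count_list u' 2"
      by (simp add: assms(4) count_before_append)
    moreover have "count_before 2 {1} (rev (p @ v)) = count_list v2 2"
      using * v by (simp add: count_before_append)
    ultimately show False
      using assms(8) cnt[of 2] v3 v by (simp add: right_data_def assms(4))
  qed
  moreover have "set v1 \<subseteq> {2, 3}"
  proof
    fix z assume "z \<in> set v1"
    then have "z \<in> {1..3}" "z \<noteq> 1" using v assms(3) by auto
    then show "z \<in> {2, 3}" by auto
  qed
  then have "separates (min z 1) (max z 1) 2 1" if "z \<in> set v1" for z
    using that by (auto simp: separates_def)
  ultimately have "\<exists>l\<in>set p. \<exists>r\<in>set v2. separates (min z 1) (max z 1) l r" if "z \<in> set v1" for z
    using that by blast
  from baxt_cong_move_front[of v1 p v2 1 3, OF this] assms(1,3) v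
  have "(p @ v1 @ 1 # v2, p @ 1 # v1 @ v2) \<in> baxt_cong 3" by simp
  with v that show thesis by auto
qed

lemma baxt_cong_right_data:
  assumes "(p, q) \<in> baxt_cong 3"
  shows "right_data p = right_data q"
  using baxt_cong_left_data[OF word_sharp_cong[OF assms]] baxt_cong_lists[OF assms]
  by (simp add: left_data_word_sharp)

text \<open>The common prefix \<open>p\<close> grows letter by letter. Where the words differ, the first letter \<open>3\<close>
  (or \<open>1\<close>, if the letters are \<open>1\<close> and \<open>2\<close>) of one of them can be produced at the front of the other:
  an obstacle to moving it there would change the data.\<close>

lemma baxt_cong_if_data:
  assumes "p @ u \<in> lists {1..3}" and "p @ v \<in> lists {1..3}" and "mset u = mset v"
    and "left_data (p @ u) = left_data (p @ v)" and "right_data (p @ u) = right_data (p @ v)"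
  shows "(p @ u, p @ v) \<in> baxt_cong 3"
  using assms
proof (induction "length u" arbitrary: p u v)
  case 0
  then show ?case using baxt_cong_refl[of p 3] by simp
next
  case (Suc n)
  \<comment> \<open>Congruent words share content and data, so the hypotheses survive when
    \<open>p @ u\<close> is replaced by a word that agrees with \<open>p @ v\<close> in one more
    letter.\<close>
  have step: "(p @ u, p @ v) \<in> baxt_cong 3"
    if "n = length u'" "v = x # v'" "(p @ u, p @ x # u') \<in> baxt_cong 3"
      "p @ u \<in> lists {1..3}" "p @ v \<in> lists {1..3}" "mset u = mset v"
      "left_data (p @ u) = left_data (p @ v)" "right_data (p @ u) = right_data (p @ v)"
    for u v u' v' x
  proof -
    note * = baxt_cong_left_data[OF that(3)] baxt_cong_right_data[OF that(3)] baxt_cong_lists[OF that(3)]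
    have "((p @ [x]) @ u', (p @ [x]) @ v') \<in> baxt_cong 3"
      using that * by (intro Suc.hyps(1)) auto
    then show ?thesis using that(2,3) baxt_cong_trans by fastforce
  qed
  obtain x u' where u: "u = x # u'" "n = length u'" using Suc.hyps(2) by (cases u) auto
  obtain y v' where v: "v = y # v'" "n = length v'"
    using Suc.hyps(2) mset_eq_length[OF Suc.prems(3)] by (cases v) auto
  have len: "length w = n" if "(p @ w', p @ z # w) \<in> baxt_cong 3" "length w' = Suc n" for w' w z
  proof -
    have "mset (p @ w') = mset (p @ z # w)" using baxt_cong_left_data[OF that(1)] by blast
    from mset_eq_length[OF this] show ?thesis using that(2) by simp
  qed
  have xy: "x \<in> {1..3}" "y \<in> {1..3}" using Suc.prems u v by auto
  have mem: "p \<in> lists {1..3}" "u \<in> lists {1..3}" "v \<in> lists {1..3}"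
    using Suc.prems by auto
  have lens: "length u = Suc n" "length v = Suc n" using u v by auto
  note sym = Suc.prems(3-5)[symmetric]
  consider "x = y" | "x \<noteq> 3" "y = 3" | "x = 3" "y \<noteq> 3" | "x = 1" "y = 2" | "x = 2" "y = 1"
    using letter_cases[OF xy(1)] letter_cases[OF xy(2)] by blast
  then show ?case
  proof cases
    case 1
    show ?thesis
      using step[OF u(2) v(1)[folded 1] _ Suc.prems] baxt_cong_refl[OF Suc.prems(1)] u(1) by simp
  next
    case 2
    obtain w where w: "(p @ u, p @ 3 # w) \<in> baxt_cong 3"
      using baxt_cong_move_three[OF mem u(1) 2(1) v(1)[unfolded 2(2)] Suc.prems(3-5)] .
    show ?thesis
      by (rule step[OF len[OF w lens(1), symmetric] v(1)[unfolded 2(2)] w Suc.prems])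
  next
    case 3
    obtain w where w: "(p @ v, p @ 3 # w) \<in> baxt_cong 3"
      using baxt_cong_move_three[OF mem(1,3,2) v(1) 3(2) u(1)[unfolded 3(1)] sym] .
    show ?thesis
      by (rule baxt_cong_sym, rule step[OF len[OF w lens(2), symmetric] u(1)[unfolded 3(1)] w Suc.prems(2,1) sym])
  next
    case 4
    obtain w where w: "(p @ v, p @ 1 # w) \<in> baxt_cong 3"
      using baxt_cong_move_one[OF mem u(1)[unfolded 4(1)] v(1)[unfolded 4(2)] Suc.prems(3-5)] .
    show ?thesis
      by (rule baxt_cong_sym, rule step[OF len[OF w lens(2), symmetric] u(1)[unfolded 4(1)] w Suc.prems(2,1) sym])
  next
    case 5
    obtain w where w: "(p @ u, p @ 1 # w) \<in> baxt_cong 3"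
      using baxt_cong_move_one[OF mem(1,3,2) v(1)[unfolded 5(2)] u(1)[unfolded 5(1)] sym] .
    show ?thesis
      by (rule step[OF len[OF w lens(1), symmetric] v(1)[unfolded 5(2)] w Suc.prems])
  qed
qed

lemma baxt_cong_three_iff:
  assumes "p \<in> lists {1..3}" and "q \<in> lists {1..3}"
  shows "(p, q) \<in> baxt_cong 3 \<longleftrightarrow>
    mset p = mset q \<and> left_data p = left_data q \<and>
    left_data (word_sharp 3 p) = left_data (word_sharp 3 q)"
  using baxt_cong_if_data[of "[]" p q] baxt_cong_left_data[of p q] baxt_cong_right_data[of p q] assms
  by (auto simp: left_data_word_sharp)

section \<open>Identities and word-valued assignments\<close>

text \<open>Choices of a representing word for the value of each variable.\<close>

definition compatible :: "('x variable \<Rightarrow> nat list) \<Rightarrow> bool" where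
  "compatible W \<longleftrightarrow> (\<forall>z. W z \<in> lists {1..3} \<and> W (star z) = word_sharp 3 (W z))"

lemma star_star [simp]: "star (star z) = z"
  by (cases z) auto

lemma star_neq [simp]: "star z \<noteq> z" "z \<noteq> star z"
  by (cases z; simp)+

lemma star_eq_iff [simp]: "star z = star w \<longleftrightarrow> z = w"
  by (metis star_star)

text \<open>The involution reverses the order of the factors and acts on each of them, which is the
  same as reading the reversed word under the starred assignment.\<close>

lemma word_sharp_concat_map:
  assumes "compatible W"
  shows "word_sharp 3 (concat (map W u)) = concat (map (W \<circ> star) (rev u))"
  using assms by (induction u) (auto simp: word_sharp_append compatible_def word_sharp_def)

lemma compatible_comp_star: "compatible W \<Longrightarrow> compatible (W \<circ> star)"
  unfolding compatible_def comp_def by blast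

lemma concat_map_lists: "compatible W \<Longrightarrow> concat (map W u) \<in> lists {1..3}"
  by (induction u) (auto simp: compatible_def)

lemma eval_word_class:
  assumes "compatible W"
  shows "eval_word (baxt 3) (sharp 3) (\<lambda>t. baxt_cong 3 `` {W (Plain t)}) u
    = baxt_cong 3 `` {concat (map W u)}"
proof (induction u)
  case Nil
  show ?case by (simp add: baxt_def)
next
  case (Cons z u)
  have W: "W z \<in> lists {1..3}" for z using assms by (simp add: compatible_def)
  have "eval_var (sharp 3) (\<lambda>t. baxt_cong 3 `` {W (Plain t)}) z = baxt_cong 3 `` {W z}"
  proof (cases z)
    case (Starred t)
    have "W (Starred t) = word_sharp 3 (W (Plain t))"
      using assms unfolding compatible_def by (metis star.simps(1))
    then show ?thesis using W sharp_class Starred by auto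
  qed simp
  then show ?case
    using Cons baxt_mult_class[OF W concat_map_lists[OF assms]] by simp
qed

text \<open>Classes are traded for representatives: a word is picked for the value of each letter,
  its starred copy gets the image under \<open>word_sharp 3\<close>, and equality of classes becomes
  congruence of two concrete words.\<close>

lemma identity_holds_iff_words:
  "identity_holds (baxt 3) (sharp 3) u v \<longleftrightarrow>
    (\<forall>W. compatible W \<longrightarrow> (concat (map W u), concat (map W v)) \<in> baxt_cong 3)"
proof
  assume *: "identity_holds (baxt 3) (sharp 3) u v"
  show "\<forall>W. compatible W \<longrightarrow> (concat (map W u), concat (map W v)) \<in> baxt_cong 3"
  proof (intro allI impI)
    fix W :: "'a variable \<Rightarrow> nat list" assume W: "compatible W"
    let ?\<phi> = "\<lambda>t. baxt_cong 3 `` {W (Plain t)}"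
    have "?\<phi> \<in> UNIV \<rightarrow> carrier (baxt 3)"
      using W unfolding compatible_def by (intro Pi_I baxt_carrierI) blast
    then have "baxt_cong 3 `` {concat (map W u)} = baxt_cong 3 `` {concat (map W v)}"
      using * eval_word_class[OF W] unfolding identity_holds_def by metis
    then show "(concat (map W u), concat (map W v)) \<in> baxt_cong 3"
      using eq_equiv_class[OF _ equiv_baxt_cong concat_map_lists[OF W]] by blast
  qed
next
  assume *: "\<forall>W. compatible W \<longrightarrow> (concat (map W u), concat (map W v)) \<in> baxt_cong 3"
  show "identity_holds (baxt 3) (sharp 3) u v"
    unfolding identity_holds_def
  proof
    fix \<phi> :: "'a \<Rightarrow> nat list set" assume "\<phi> \<in> UNIV \<rightarrow> carrier (baxt 3)"
    then have "\<exists>p. p \<in> lists {1..3} \<and> \<phi> t = baxt_cong 3 `` {p}" for t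
      by (metis PiE UNIV_I baxt_carrierE)
    then obtain f where f: "\<And>t. f t \<in> lists {1..3}" "\<And>t. \<phi> t = baxt_cong 3 `` {f t}"
      by metis
    let ?W = "\<lambda>z. case z of Plain t \<Rightarrow> f t | Starred t \<Rightarrow> word_sharp 3 (f t)"
    have W: "compatible ?W"
      unfolding compatible_def using f word_sharp_lists[OF f(1)] word_sharp_word_sharp[OF f(1)]
      by (auto split: variable.split)
    have "\<phi> = (\<lambda>t. baxt_cong 3 `` {?W (Plain t)})" using f by auto
    then show "eval_word (baxt 3) (sharp 3) \<phi> u = eval_word (baxt 3) (sharp 3) \<phi> v"
      using eval_word_class[OF W] equiv_class_eq[OF equiv_baxt_cong *[rule_format, OF W]] by simp
  qed
qed

section \<open>Reduction to the left data\<close>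

definition left_equivalent :: "'x variable list \<Rightarrow> 'x variable list \<Rightarrow> bool" where
  "left_equivalent u v \<longleftrightarrow> (\<forall>W. compatible W \<longrightarrow>
     mset (concat (map W u)) = mset (concat (map W v)) \<and>
     left_data (concat (map W u)) = left_data (concat (map W v)))"

text \<open>The right data of \<open>u\<close> under \<open>W\<close> are the left data of
  \<open>rev u\<close> under \<open>W \<circ> star\<close>. Composition with \<open>star\<close>
  maps compatible assignments to compatible ones and is its own inverse, so the star disappears
  under the quantifier.\<close>

lemma identity_holds_iff_left_equivalent:
  "identity_holds (baxt 3) (sharp 3) u v \<longleftrightarrow> left_equivalent u v \<and> left_equivalent (rev u) (rev v)"
proof
  assume *: "identity_holds (baxt 3) (sharp 3) u v"
  have "left_equivalent u v"
    unfolding left_equivalent_def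
    using *[unfolded identity_holds_iff_words] baxt_cong_left_data by blast
  moreover have "left_equivalent (rev u) (rev v)"
    unfolding left_equivalent_def
  proof (intro allI impI)
    fix W :: "'a variable \<Rightarrow> nat list" assume W: "compatible W"
    have "(concat (map (W \<circ> star) u), concat (map (W \<circ> star) v)) \<in> baxt_cong 3"
      using * compatible_comp_star[OF W] by (simp add: identity_holds_iff_words)
    from baxt_cong_left_data[OF word_sharp_cong[OF this],
        unfolded word_sharp_concat_map[OF compatible_comp_star[OF W]]]
    show "mset (concat (map W (rev u))) = mset (concat (map W (rev v))) \<and>
      left_data (concat (map W (rev u))) = left_data (concat (map W (rev v)))"
      by (simp add: comp_def)
  qed
  ultimately show "left_equivalent u v \<and> left_equivalent (rev u) (rev v)" ..
next
  assume *: "left_equivalent u v \<and> left_equivalent (rev u) (rev v)"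
  show "identity_holds (baxt 3) (sharp 3) u v"
    unfolding identity_holds_iff_words
  proof (intro allI impI)
    fix W :: "'a variable \<Rightarrow> nat list" assume W: "compatible W"
    show "(concat (map W u), concat (map W v)) \<in> baxt_cong 3"
      unfolding baxt_cong_three_iff[OF concat_map_lists[OF W] concat_map_lists[OF W]]
        word_sharp_concat_map[OF W]
      using * W compatible_comp_star[OF W] unfolding left_equivalent_def by blast
  qed
qed

text \<open>The parts (a) of (I)--(V). The parts (b) for \<open>u\<close> and \<open>v\<close> are the parts (a) for \<open>rev u\<close> and \<open>rev v\<close>.\<close>

definition left_conditions :: "'x variable list \<Rightarrow> 'x variable list \<Rightarrow> bool" where
  "left_conditions u v \<longleftrightarrow> (\<forall>x \<in> con u. \<forall>y. x \<noteq> y \<and> star x \<noteq> y \<longrightarrow>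
    (\<forall>\<alpha>\<ge>1. (\<exists>r. retain u x y = replicate \<alpha> x @ star x # r)
      \<longrightarrow> (\<exists>r. retain v x y = replicate \<alpha> x @ star x # r)) \<and>
    (y \<in> con u \<longrightarrow>
      (\<forall>\<alpha>\<ge>1. (\<exists>r. retain u x y = replicate \<alpha> y @ x # r)
        \<longrightarrow> (\<exists>r. retain v x y = replicate \<alpha> y @ x # r)) \<and>
      (\<forall>a. con a = {star x, star y} \<and> (\<exists>r. retain u x y = a @ x # r)
        \<longrightarrow> (\<exists>a' r. mset a' = mset a \<and> retain v x y = a' @ x # r)) \<and>
      occ_before_first y x u + occ_before_first y (star x) u
        = occ_before_first y x v + occ_before_first y (star x) v \<and>
      (\<forall>a. con a = {x, star x} \<and> (\<exists>r. retain u x y = a @ y # r)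
        \<longrightarrow> (\<exists>a' r. mset a' = mset a \<and> retain v x y = a' @ y # r))))"

lemma left_conditionsD:
  assumes "left_conditions u v" and "x \<in> con u" and "x \<noteq> y" and "star x \<noteq> y"
  shows "retain u x y = replicate \<alpha> x @ star x # r \<Longrightarrow> \<alpha> \<ge> 1 \<Longrightarrow>
      \<exists>r. retain v x y = replicate \<alpha> x @ star x # r"
    and "y \<in> con u \<Longrightarrow> retain u x y = replicate \<alpha> y @ x # r \<Longrightarrow> \<alpha> \<ge> 1 \<Longrightarrow>
      \<exists>r. retain v x y = replicate \<alpha> y @ x # r"
    and "y \<in> con u \<Longrightarrow> con a = {star x, star y} \<Longrightarrow> retain u x y = a @ x # r \<Longrightarrow>
      \<exists>a' r. mset a' = mset a \<and> retain v x y = a' @ x # r"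
    and "y \<in> con u \<Longrightarrow> occ_before_first y x u + occ_before_first y (star x) u
        = occ_before_first y x v + occ_before_first y (star x) v"
    and "y \<in> con u \<Longrightarrow> con a = {x, star x} \<Longrightarrow> retain u x y = a @ y # r \<Longrightarrow>
      \<exists>a' r. mset a' = mset a \<and> retain v x y = a' @ y # r"
  using assms unfolding left_conditions_def by blast+

section \<open>Transfer of initial blocks of retained words\<close>

lemma retain_append [simp]: "retain (a @ b) x y = retain a x y @ retain b x y"
  by (simp add: retain_def)

lemma retain_Cons [simp]:
  "retain (z # w) x y = (if z \<in> var_pair x y then z # retain w x y else retain w x y)"
  by (simp add: retain_def)

lemma set_retain: "set (retain w x y) = set w \<inter> var_pair x y"
  by (auto simp: retain_def)

lemma mset_retain_cong: "mset u = mset v \<Longrightarrow> mset (retain u x y) = mset (retain v x y)"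
  by (simp add: retain_def)

lemma count_list_retain: "z \<in> var_pair x y \<Longrightarrow> count_list (retain w x y) z = count_list w z"
  by (induction w) (auto simp: retain_def)

lemma retain_cong: "var_pair x y = var_pair x' y' \<Longrightarrow> retain w x y = retain w x' y'"
  by (simp add: retain_def)

lemma var_pair_eqI:
  assumes "z \<in> var_pair x y" and "w \<in> var_pair x y" and "w \<noteq> z" and "w \<noteq> star z"
  shows "var_pair z w = var_pair x y"
  using assms by (auto simp: var_pair_def)

text \<open>Conditions (I) and (II) merge into one statement about any two distinct variables of the
  pair, because \<open>retain\<close> depends only on the set \<open>var_pair x y\<close>. If
  \<open>w = star z\<close>, this is (I) for \<open>z\<close>; otherwise it is (II) with
  \<open>w\<close> and \<open>z\<close> in the roles of \<open>x\<close> and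
  \<open>y\<close>.\<close>

lemma retain_run:
  assumes bal: "mset u = mset v" and lc: "left_conditions u v"
    and xy: "y \<noteq> x" "y \<noteq> star x" and zw: "z \<in> var_pair x y" "w \<in> var_pair x y" "w \<noteq> z"
    and eq: "retain u x y = replicate \<alpha> z @ w # r" and "\<alpha> \<ge> 1"
  shows "\<exists>r. retain v x y = replicate \<alpha> z @ w # r"
proof -
  have "set (retain u x y) = insert z (insert w (set r))"
    using eq \<open>\<alpha> \<ge> 1\<close> by auto
  then have mem: "z \<in> con u" "w \<in> con u"
    by (auto simp: set_retain)
  show ?thesis
  proof (cases "w = star z")
    case True
    \<comment> \<open>The partner of \<open>z\<close> need not occur in \<open>u\<close>; here the
      wider range of \<open>y\<close> in (I) is used.\<close>
    define y' where "y' = (if z \<in> {x, star x} then y else x)"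
    have y': "z \<noteq> y'" "star z \<noteq> y'" "y' \<in> var_pair x y"
      using xy zw(1) by (auto simp: y'_def var_pair_def)
    then have "var_pair z y' = var_pair x y"
      using zw(1) by (intro var_pair_eqI) auto
    note re = retain_cong[OF this]
    show ?thesis
      using left_conditionsD(1)[OF lc mem(1) y'(1,2)] eq \<open>\<alpha> \<ge> 1\<close> by (simp add: re True)
  next
    case False
    then have "w \<noteq> z" "star w \<noteq> z" using zw by auto
    moreover have "var_pair w z = var_pair x y"
      using zw calculation by (intro var_pair_eqI) auto
    note re = retain_cong[OF this]
    ultimately show ?thesis
      using left_conditionsD(2)[OF lc mem(2) _ _ mem(1)] eq \<open>\<alpha> \<ge> 1\<close> by (simp add: re)
  qed
qed

text \<open>The leading run of \<open>z\<close> either ends at another letter, and then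
  \<open>retain_run\<close> applies, or fills the whole word, and then the content leaves no
  choice.\<close>

lemma retain_first:
  assumes bal: "mset u = mset v" and lc: "left_conditions u v"
    and xy: "y \<noteq> x" "y \<noteq> star x" and eq: "retain u x y = z # r"
  shows "\<exists>r. retain v x y = z # r"
proof -
  define a where "a = takeWhile (\<lambda>t. t = z) (z # r)"
  define s where "s = dropWhile (\<lambda>t. t = z) (z # r)"
  have as: "a @ s = z # r" unfolding a_def s_def by (rule takeWhile_dropWhile_id)
  have "\<forall>t\<in>set a. t = z" unfolding a_def by (metis set_takeWhileD)
  then have rep: "a = replicate (length a) z" using replicate_length_same by metis
  have len: "length a \<ge> 1" by (simp add: a_def)
  have sets: "set (retain v x y) = set (z # r)"
    using mset_eq_setD[OF mset_retain_cong[OF bal, of x y]] eq by simp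
  have zin: "set (z # r) \<subseteq> var_pair x y" using eq set_retain[of u x y] by auto
  show ?thesis
  proof (cases s)
    case Nil
    then have "a = z # r" using as by simp
    with \<open>\<forall>t\<in>set a. t = z\<close> have "set (retain v x y) = {z}"
      unfolding sets by auto
    then show ?thesis by (cases "retain v x y") auto
  next
    case (Cons w s')
    have "hd s \<noteq> z" unfolding s_def
      by (rule hd_dropWhile, fold s_def) (simp add: Cons)
    then have "w \<noteq> z" by (simp add: Cons)
    moreover have "w \<in> set (z # r)" unfolding as[symmetric] Cons by simp
    moreover have "retain u x y = replicate (length a) z @ w # s'"
      using as Cons eq rep by metis
    ultimately obtain r' where "retain v x y = replicate (length a) z @ w # r'"
      using retain_run[OF bal lc xy, of z w "length a" s'] zin len by auto
    moreover obtain n where "length a = Suc n" using len by (cases "length a") auto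
    ultimately show ?thesis by simp
  qed
qed

text \<open>A block over at most two variables is empty, a run, or contains both. The first two
  cases follow from (I) and (II); the third is left as a hypothesis, to be supplied by (III) or
  (V).\<close>

lemma retain_block:
  assumes bal: "mset u = mset v" and lc: "left_conditions u v"
    and xy: "y \<noteq> x" "y \<noteq> star x" and eq: "retain u x y = a @ b # r"
    and a: "set a \<subseteq> {p, q}" "b \<notin> set a"
    and both: "p \<noteq> q \<Longrightarrow> set a = {p, q} \<Longrightarrow> \<exists>a' r. mset a' = mset a \<and> retain v x y = a' @ b # r"
  shows "\<exists>a' r. mset a' = mset a \<and> retain v x y = a' @ b # r"
proof -
  have single: ?thesis if "set a = {t}" for t
  proof -
    have rep: "a = replicate (length a) t"
      using that replicate_length_same[of a t] by auto
    have "{t, b} \<subseteq> var_pair x y"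
      using that eq set_retain[of u x y] by auto
    moreover have "length a \<ge> 1" using that by (cases a) auto
    moreover have "b \<noteq> t" using a that by auto
    moreover have eq': "retain u x y = replicate (length a) t @ b # r" using eq rep by metis
    ultimately obtain r' where "retain v x y = replicate (length a) t @ b # r'"
      using retain_run[OF bal lc xy, of t b "length a" r] eq' by blast
    with rep show ?thesis by metis
  qed
  have "set a = {} \<or> set a = {p} \<or> set a = {q} \<or> set a = {p, q}"
  proof -
    have "set a = {}" if "p \<notin> set a" "q \<notin> set a"
      using that a(1) by (cases a) auto
    then show ?thesis using a(1) by (cases "p \<in> set a"; cases "q \<in> set a") blast+
  qed
  then consider "a = []" | t where "set a = {t}" | "set a = {p, q}" "p \<noteq> q"
    by (metis insert_absorb2 set_empty)
  then show ?thesis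
  proof cases
    case 1
    then show ?thesis using retain_first[OF bal lc xy, of b r] eq by auto
  qed (use single both in auto)
qed

section \<open>The first stopping variable and the prefix before it\<close>

lemma takeWhile_append_Cons_first:
  "b \<notin> set a \<Longrightarrow> takeWhile (\<lambda>z. z \<noteq> b) (a @ b # r) = a"
  by (induction a) auto

lemma append_Cons_first_unique:
  assumes "a @ b # r = a' @ b # r'" and "b \<notin> set a" and "b \<notin> set a'"
  shows "a = a'"
  using assms by (metis takeWhile_append_Cons_first)

text \<open>Retaining \<open>b\<close> together with a variable absent from \<open>u\<close>
  restricts \<open>u\<close> to \<open>b\<close> and \<open>star b\<close> alone, so the
  two-variable conditions also speak about a single letter.\<close>

lemma fresh_variable:
  fixes u :: "'x::infinite variable list"
  obtains y where "y \<notin> con u" and "star y \<notin> con u" and "y \<noteq> b" and "star y \<noteq> b"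
proof -
  define X where "X = insert b (con u)"
  have "finite (Plain -` X \<union> Starred -` X)"
    unfolding X_def by (intro finite_UnI finite_vimageI injI) auto
  then obtain t where "t \<notin> Plain -` X \<union> Starred -` X"
    using ex_new_if_finite[OF infinite_UNIV] by blast
  then show thesis using that[of "Plain t"] by (auto simp: X_def)
qed

lemma retain_fresh:
  assumes "y \<notin> con w" and "star y \<notin> con w"
  shows "set (retain w b y) = con w \<inter> {b, star b}"
  using assms by (auto simp: set_retain var_pair_def)

text \<open>\<open>B\<close> will be the set of variables whose word contains a letter that stops \<open>count_before\<close>.\<close>

lemma first_in_set:
  fixes u :: "'x::infinite variable list"
  assumes bal: "mset u = mset v" and lc: "left_conditions u v"
    and u: "u = a @ b # r" "con a \<inter> B = {}" "b \<in> B"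
  shows "\<exists>a' r'. v = a' @ b # r' \<and> con a' \<inter> B = {}"
proof -
  have sets: "con v = con u" using mset_eq_setD[OF bal] by simp
  have "\<exists>z\<in>con v. z \<in> B" using sets u by auto
  then obtain a' b' r' where v: "v = a' @ b' # r'" "b' \<in> B" "\<forall>z\<in>con a'. z \<notin> B"
    by (rule split_list_first_propE)
  have "b' = b"
  proof (rule ccontr)
    assume "b' \<noteq> b"
    show False
    proof (cases "b' = star b")
      case True
      obtain y where y: "y \<notin> con u" "star y \<notin> con u" "y \<noteq> b" "star y \<noteq> b"
        using fresh_variable .
      then have yb: "y \<noteq> star b" by auto
      \<comment> \<open>Now both \<open>b\<close> and \<open>star b\<close> lie in \<open>B\<close>,
        so neither occurs in \<open>a\<close> or \<open>a'\<close>, and the retained words begin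
        with different letters.\<close>
      have "set (retain a b y) = {}" "set (retain a' b y) = {}"
        using y u v True sets by (subst retain_fresh; auto)+
      then have "retain u b y = b # retain r b y" "retain v b y = b' # retain r' b y"
        using u v True by (auto simp: var_pair_def)
      then show False
        using retain_first[OF bal lc y(3) yb] \<open>b' \<noteq> b\<close> by fastforce
    next
      case False
      have mem: "b \<in> var_pair b b'" "b' \<in> var_pair b b'" by (auto simp: var_pair_def)
      have U: "retain u b b' = retain a b b' @ b # retain r b b'"
        using u mem by simp
      have V: "retain v b b' = retain a' b b' @ b' # retain r' b b'"
        using v mem by simp
      \<comment> \<open>Before \<open>b\<close> only \<open>star b\<close> and
        \<open>star b'\<close> can be retained, the situation of (III). A permutation of this block,
        followed by \<open>b\<close>, then starts the retained word of \<open>v\<close>, so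
        \<open>b'\<close> cannot come before \<open>b\<close> there.\<close>
      have "set (retain a b b') \<subseteq> {star b, star b'}" "b \<notin> set (retain a b b')"
        using u v by (auto simp: set_retain var_pair_def)
      moreover have "b \<in> con u" "b' \<in> con u" using u v sets by auto
      ultimately obtain a'' s where
        *: "mset a'' = mset (retain a b b')" "retain v b b' = a'' @ b # s"
        using retain_block[OF bal lc \<open>b' \<noteq> b\<close> False U] left_conditionsD(3)[OF lc _ _ _ _ _ U]
          \<open>b' \<noteq> b\<close> False by metis
      have "b' \<notin> set a''" "b \<notin> set a''"
        using mset_eq_setD[OF *(1)] u v by (auto simp: set_retain)
      moreover have "b \<notin> set (retain a' b b')"
        using u v by (auto simp: set_retain)
      moreover have "takeWhile (\<lambda>z. z \<noteq> b) (retain v b b') = a''"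
        using *(2) calculation by (simp add: takeWhile_append_Cons_first)
      moreover have "\<forall>z\<in>set (retain a' b b'). z \<noteq> b" using calculation by auto
      then have "b' \<in> set (takeWhile (\<lambda>z. z \<noteq> b) (retain v b b'))"
        unfolding V using \<open>b' \<noteq> b\<close> by (simp add: takeWhile_append2)
      ultimately show False by simp
    qed
  qed
  with v show ?thesis by auto
qed

text \<open>(IV) settles the sums for every \<open>z\<close> other than \<open>b\<close> and
  \<open>star b\<close>. Exact counts need (V), which speaks of prefixes free of
  \<open>star b\<close>; this is what closure of \<open>B\<close> under \<open>star\<close>
  provides.\<close>

lemma prefix_counts:
  fixes u :: "'x::infinite variable list"
  assumes bal: "mset u = mset v" and lc: "left_conditions u v"
    and u: "u = a @ b # r" "con a \<inter> B = {}" "b \<in> B"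
    and v: "v = a' @ b # r'" "con a' \<inter> B = {}"
  shows "occ z a + occ (star z) a = occ z a' + occ (star z) a'"
    and "star ` B \<subseteq> B \<Longrightarrow> occ z a = occ z a'"
proof -
  have sets: "con v = con u" using mset_eq_setD[OF bal] by simp
  have b: "b \<in> con u" "b \<notin> con a" "b \<notin> con a'" using u v by auto
  have b0: "occ b a = 0" "occ b a' = 0" using b by (simp_all add: count_list_0_iff)
  obtain y where y: "y \<notin> con u" "star y \<notin> con u" "y \<noteq> b" "star y \<noteq> b"
    using fresh_variable .
  then have yb: "y \<noteq> star b" by auto
  have mem: "b \<in> var_pair b y" "star b \<in> var_pair b y" by (auto simp: var_pair_def)
  \<comment> \<open>Without closure, \<open>star b\<close> may occur in the prefixes. Next to a
    fresh \<open>y\<close>, its occurrences before \<open>b\<close> form a run, whose length (I)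
    fixes.\<close>
  have "set (retain a b y) \<subseteq> {star b, star b}" "b \<notin> set (retain a b y)"
    using y u b by (subst retain_fresh; auto)+
  then obtain a'' s where *: "mset a'' = mset (retain a b y)" "retain v b y = a'' @ b # s"
    using retain_block[OF bal lc y(3) yb, of "retain a b y" b "retain r b y" "star b" "star b"]
      u(1) mem(1) by auto
  have "a'' @ b # s = retain a' b y @ b # retain r' b y"
    using *(2) v(1) mem(1) by simp
  moreover have "b \<notin> set a''" "b \<notin> set (retain a' b y)"
    using mset_eq_setD[OF *(1)] b by (auto simp: set_retain)
  ultimately have "mset (retain a' b y) = mset (retain a b y)"
    using *(1) append_Cons_first_unique by metis
  then have sb: "occ (star b) a = occ (star b) a'"
    using mem(2) by (metis count_list_retain count_mset)
  have pair: "occ z a + occ (star z) a = occ z a' + occ (star z) a'"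
    if "z \<in> con u" "z \<noteq> b" "star z \<noteq> b" for z
  proof -
    have "takeWhile (\<lambda>z. z \<noteq> b) u = a" "takeWhile (\<lambda>z. z \<noteq> b) v = a'"
      using u(1) v(1) b by (simp_all add: takeWhile_append_Cons_first)
    then show ?thesis
      using left_conditionsD(4)[OF lc that b(1)] by (simp add: occ_before_first_def)
  qed
  have absent: "occ z a = 0" "occ z a' = 0" if "z \<notin> con u" for z
    using that u(1) v(1) sets by (auto simp: count_list_0_iff)
  consider "z = b" | "z = star b" | "z \<noteq> b" "star z \<noteq> b" "z \<in> con u"
    | "z \<noteq> b" "star z \<noteq> b" "star z \<in> con u" | "z \<notin> con u" "star z \<notin> con u"
    by (metis star_star)
  then show "occ z a + occ (star z) a = occ z a' + occ (star z) a'"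
  proof cases
    case 4
    then show ?thesis using pair[of "star z"] by (auto simp: add.commute)
  qed (use sb b0 pair absent in auto)
  assume closed: "star ` B \<subseteq> B"
  show "occ z a = occ z a'"
  proof (cases "z = b \<or> z = star b \<or> z \<notin> con u")
    case True
    then show ?thesis using b0 sb absent by auto
  next
    case False
    then have z: "b \<noteq> z" "b \<noteq> star z" "z \<noteq> b" "star z \<noteq> b" "z \<in> con u" by auto
    have mem: "b \<in> var_pair z b" "z \<in> var_pair z b" by (auto simp: var_pair_def)
    have U: "retain u z b = retain a z b @ b # retain r z b"
      using u mem by simp
    \<comment> \<open>Only \<open>z\<close> and \<open>star z\<close> are now retained before
      \<open>b\<close>, so \<open>retain_block\<close> applies, with (V) for the case that both
      occur.\<close>
    have "star b \<notin> con a" "star b \<notin> con a'" using closed u v by auto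
    then have "set (retain a z b) \<subseteq> {z, star z}" "b \<notin> set (retain a z b)"
      using b by (auto simp: set_retain var_pair_def)
    then obtain a'' s where
      *: "mset a'' = mset (retain a z b)" "retain v z b = a'' @ b # s"
      using retain_block[OF bal lc z(1,2) U] left_conditionsD(5)[OF lc z(5,3,4) b(1) _ U] by metis
    have "a'' @ b # s = retain a' z b @ b # retain r' z b"
      using *(2) v(1) mem(1) by simp
    moreover have "b \<notin> set a''" "b \<notin> set (retain a' z b)"
      using mset_eq_setD[OF *(1)] b by (auto simp: set_retain)
    ultimately have "mset (retain a' z b) = mset (retain a z b)"
      using *(1) append_Cons_first_unique by metis
    then show ?thesis using mem(2) by (metis count_list_retain count_mset)
  qed
qed

section \<open>Conditions and identities\<close>

lemma count_before_concat_map: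
  assumes "\<forall>z\<in>set a. set (W z) \<inter> S = {}" and "set (W b) \<inter> S \<noteq> {}"
  shows "count_before c S (concat (map W (a @ b # r)))
    = (\<Sum>z\<leftarrow>a. count_list (W z) c) + count_before c S (W b)"
  using assms by (induction a) (auto simp: count_before_append)

lemma count_before_disjoint: "set w \<inter> S = {} \<Longrightarrow> count_before c S w = count_list w c"
  using count_before_append[of c S w "[]"] by simp

lemma sum_list_map_mset_cong:
  fixes f :: "'a \<Rightarrow> 'b::comm_monoid_add"
  assumes "mset xs = mset ys"
  shows "sum_list (map f xs) = sum_list (map f ys)"
proof -
  have "mset (map f xs) = mset (map f ys)" using assms by simp
  then show ?thesis by (simp only: sum_mset_sum_list[symmetric])
qed

lemma mset_concat_map_cong: "mset u = mset v \<Longrightarrow> mset (concat (map W u)) = mset (concat (map W v))"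
proof -
  have "mset (concat (map W w)) = \<Sum>\<^sub># (image_mset (\<lambda>z. mset (W z)) (mset w))" for w
    by (induction w) auto
  then show "mset u = mset v \<Longrightarrow> ?thesis" by simp
qed

lemma count_list_map_star: "count_list (map star w) z = count_list w (star z)"
  by (induction w) auto

text \<open>The count is a sum over the prefix before the first stopping variable \<open>b\<close>,
  plus a term from \<open>W b\<close>, so only the prefix sums must agree. The hypothesis
  \<open>sym\<close> lists three reasons for this: the prefixes have equal content, a variable and
  its star contribute equally, or the star of a non-stopping variable contributes nothing.\<close>

lemma count_before_eqI:
  fixes u :: "'x::infinite variable list"
  assumes bal: "mset u = mset v" and lc: "left_conditions u v"
    and sym: "star ` {z. set (W z) \<inter> S \<noteq> {}} \<subseteq> {z. set (W z) \<inter> S \<noteq> {}} \<or>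
      (\<forall>z. count_list (W (star z)) c = count_list (W z) c) \<or>
      (\<forall>z. set (W z) \<inter> S = {} \<longrightarrow> count_list (W (star z)) c = 0)"
  shows "count_before c S (concat (map W u)) = count_before c S (concat (map W v))"
proof (cases "\<exists>z\<in>con u. set (W z) \<inter> S \<noteq> {}")
  case False
  have sets: "con v = con u" using mset_eq_setD[OF bal] by simp
  have "set (concat (map W u)) \<inter> S = {}" "set (concat (map W v)) \<inter> S = {}"
    using False sets by auto
  then show ?thesis
    using mset_concat_map_cong[OF bal, of W]
    by (simp add: count_before_disjoint mset_eq_iff_count_list)
next
  case True
  define B where "B = {z. set (W z) \<inter> S \<noteq> {}}"
  have "\<exists>z\<in>con u. z \<in> B" using True by (simp add: B_def)
  then obtain a b r where u: "u = a @ b # r" "b \<in> B" "\<forall>z\<in>con a. z \<notin> B"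
    by (rule split_list_first_propE)
  then have aB: "con a \<inter> B = {}" by auto
  obtain a' r' where v: "v = a' @ b # r'" "con a' \<inter> B = {}"
    using first_in_set[OF bal lc u(1) aB u(2)] by blast
  let ?f = "\<lambda>z. count_list (W z) c"
  note counts = prefix_counts[OF bal lc u(1) aB u(2) v]
  have "mset (a @ map star a) = mset (a' @ map star a')"
    using counts(1) by (simp only: mset_eq_iff_count_list count_list_append count_list_map_star) simp
  from sum_list_map_mset_cong[OF this, of ?f]
  \<comment> \<open>Only the sums \<open>occ z a + occ (star z) a\<close> are known to agree, so we double the prefixes.\<close>
  have double: "(\<Sum>z\<leftarrow>a. ?f z) + (\<Sum>z\<leftarrow>a. ?f (star z)) = (\<Sum>z\<leftarrow>a'. ?f z) + (\<Sum>z\<leftarrow>a'. ?f (star z))"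
    by (simp add: comp_def)
  have "(\<Sum>z\<leftarrow>a. ?f z) = (\<Sum>z\<leftarrow>a'. ?f z)"
    using sym
  proof (elim disjE)
    assume "star ` {z. set (W z) \<inter> S \<noteq> {}} \<subseteq> {z. set (W z) \<inter> S \<noteq> {}}"
    then have "mset a = mset a'"
      using counts(2) by (simp add: B_def mset_eq_iff_count_list)
    then show ?thesis by (rule sum_list_map_mset_cong)
  next
    assume "\<forall>z. ?f (star z) = ?f z"
    then show ?thesis using double by simp
  next
    assume *: "\<forall>z. set (W z) \<inter> S = {} \<longrightarrow> ?f (star z) = 0"
    have zero: "(\<Sum>z\<leftarrow>w. ?f (star z)) = 0" if "con w \<inter> B = {}" for w
      using that * by (induction w) (auto simp: B_def)
    show ?thesis using double unfolding zero[OF aB] zero[OF v(2)] by simp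
  qed
  moreover have W: "\<forall>z\<in>con a. set (W z) \<inter> S = {}" "\<forall>z\<in>con a'. set (W z) \<inter> S = {}"
    "set (W b) \<inter> S \<noteq> {}"
    using u aB v by (auto simp: B_def)
  ultimately show ?thesis
    unfolding u(1) v(1) count_before_concat_map[OF W(1,3)] count_before_concat_map[OF W(2,3)]
    by simp
qed

lemma set_word_sharp_iff: "w \<in> lists {1..3} \<Longrightarrow> i \<in> {1..3} \<Longrightarrow> i \<in> set (word_sharp 3 w) \<longleftrightarrow> 4 - i \<in> set w"
  by (induction w) (auto simp: word_sharp_def)

lemma count_list_word_sharp:
  "w \<in> lists {1..3} \<Longrightarrow> i \<in> {1..3} \<Longrightarrow> count_list (word_sharp 3 w) i = count_list w (4 - i)"
  by (induction w) (auto simp: word_sharp_def)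

lemma left_equivalentI:
  fixes u :: "'x::infinite variable list"
  assumes bal: "mset u = mset v" and lc: "left_conditions u v"
  shows "left_equivalent u v"
  unfolding left_equivalent_def
proof (intro allI impI conjI)
  fix W :: "'x variable \<Rightarrow> nat list" assume W: "compatible W"
  then have mem: "\<And>z. W z \<in> lists {1..3}" and st: "\<And>z. W (star z) = word_sharp 3 (W z)"
    by (simp_all add: compatible_def)
  show "mset (concat (map W u)) = mset (concat (map W v))"
    by (rule mset_concat_map_cong[OF bal])
  \<comment> \<open>A word without 2 and 3 is a power of 1, and the involution makes it a power of
    3.\<close>
  have "count_list (W (star z)) 1 = 0" if "set (W z) \<inter> {2, 3} = {}" for z
    using that count_list_word_sharp[OF mem[of z], of 1] by (simp add: st count_list_0_iff)
  then have "count_before 1 {2, 3} (concat (map W u)) = count_before 1 {2, 3} (concat (map W v))"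
    by (intro count_before_eqI[OF bal lc]) blast
  moreover have "2 \<in> set (W (star z))" if "2 \<in> set (W z)" for z
    using that set_word_sharp_iff[OF mem[of z], of 2] by (simp add: st)
  then have "count_before 1 {2} (concat (map W u)) = count_before 1 {2} (concat (map W v))"
    by (intro count_before_eqI[OF bal lc]) auto
  moreover have "count_list (W (star z)) 2 = count_list (W z) 2" for z
    using count_list_word_sharp[OF mem[of z], of 2] by (simp add: st)
  then have "count_before 2 {3} (concat (map W u)) = count_before 2 {3} (concat (map W v))"
    by (intro count_before_eqI[OF bal lc]) blast
  ultimately show "left_data (concat (map W u)) = left_data (concat (map W v))"
    by (simp add: left_data_def)
qed

section \<open>Necessity of the conditions by test assignments\<close>

lemma ex_compatible:
  assumes "x \<noteq> y" and "star x \<noteq> y" and "p \<in> lists {1..3}" and "q \<in> lists {1..3}"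
  shows "\<exists>W. compatible W \<and> W x = p \<and> W y = q \<and> (\<forall>z. z \<notin> var_pair x y \<longrightarrow> W z = [])"
proof -
  let ?W = "\<lambda>z. if z = x then p else if z = star x then word_sharp 3 p
    else if z = y then q else if z = star y then word_sharp 3 q else []"
  have "compatible ?W"
    unfolding compatible_def
  proof
    fix z
    have "star z = x \<longleftrightarrow> z = star x" "star z = y \<longleftrightarrow> z = star y" by auto
    then show "?W z \<in> lists {1..3} \<and> ?W (star z) = word_sharp 3 (?W z)"
      using assms word_sharp_lists[OF assms(3)] word_sharp_lists[OF assms(4)]
        word_sharp_word_sharp[OF assms(3)] word_sharp_word_sharp[OF assms(4)]
      by (cases "z = x"; cases "z = star x"; cases "z = y"; cases "z = star y")
        (auto simp: word_sharp_def)
  qed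
  moreover have "?W x = p" "?W y = q" "\<forall>z. z \<notin> var_pair x y \<longrightarrow> ?W z = []"
    using assms by (auto simp: var_pair_def)
  ultimately show ?thesis by blast
qed

lemma concat_map_retain:
  "\<forall>z. z \<notin> var_pair x y \<longrightarrow> W z = [] \<Longrightarrow> concat (map W (retain u x y)) = concat (map W u)"
  by (induction u) (auto simp: retain_def)

text \<open>Variables outside the pair become empty, so the data depend on the retained words alone,
  and a condition can be read off from a suitable choice of \<open>p\<close> and
  \<open>q\<close>.\<close>

lemma left_equivalent_probe:
  assumes "left_equivalent u v" and "x \<noteq> y" and "star x \<noteq> y"
    and "p \<in> lists {1..3}" and "q \<in> lists {1..3}"
  obtains W where "W x = p" and "W (star x) = word_sharp 3 p"
    and "W y = q" and "W (star y) = word_sharp 3 q"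
    and "\<forall>z. z \<notin> var_pair x y \<longrightarrow> W z = []"
    and "left_data (concat (map W (retain u x y))) = left_data (concat (map W (retain v x y)))"
    and "mset (concat (map W u)) = mset (concat (map W v))"
proof -
  obtain W where W: "compatible W" "W x = p" "W y = q" "\<forall>z. z \<notin> var_pair x y \<longrightarrow> W z = []"
    using ex_compatible[OF assms(2-5)] by blast
  have "W (star x) = word_sharp 3 p" "W (star y) = word_sharp 3 q"
    using W by (simp_all add: compatible_def)
  then show thesis
    using that[OF W(2) _ W(3) _ W(4)] W assms(1)
    by (simp add: left_equivalent_def concat_map_retain)
qed

lemma left_equivalent_mset:
  fixes u :: "'x::infinite variable list"
  assumes "left_equivalent u v"
  shows "mset u = mset v"
  unfolding mset_eq_iff_count_list
proof
  fix x :: "'x variable"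
  obtain y where y: "y \<noteq> x" "star y \<noteq> x"
    using fresh_variable[of "[]" x] by metis
  then have "x \<noteq> y" "star x \<noteq> y" by auto
  \<comment> \<open>The value of \<open>star x\<close> is 3, so the number of 1s counts
    \<open>x\<close> separately from \<open>star x\<close>.\<close>
  then obtain W where W: "W x = [1]" "W (star x) = word_sharp 3 [1]" "W y = []"
    "W (star y) = word_sharp 3 []" "\<forall>z. z \<notin> var_pair x y \<longrightarrow> W z = []"
    "mset (concat (map W u)) = mset (concat (map W v))"
    using left_equivalent_probe[OF assms, of x y "[1]" "[]"] by auto
  have "count_list (concat (map W w)) 1 = count_list w x" for w
  proof (induction w)
    case (Cons z w)
    have "count_list (W z) 1 = (if z = x then 1 else 0)"
      using W y by (cases "z \<in> var_pair x y") (auto simp: var_pair_def word_sharp_def)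
    then show ?case using Cons by simp
  qed simp
  then show "count_list u x = count_list v x"
    using W(6) unfolding mset_eq_iff_count_list by metis
qed

lemma count_before_replicate [simp]:
  "i \<notin> S \<Longrightarrow> count_before c S (replicate n i @ w) = (if i = c then n else 0) + count_before c S w"
  by (induction n) auto

lemma concat_map_replicate [simp]: "W x = [i] \<Longrightarrow> concat (map W (replicate n x)) = replicate n i"
  by (induction n) auto

lemma count_before_two:
  assumes "set a \<subseteq> {p, q}" and "p \<noteq> q" and "set (W p) \<inter> S = {}" and "set (W q) \<inter> S = {}"
  shows "count_before c S (concat (map W a) @ w)
    = occ p a * count_list (W p) c + occ q a * count_list (W q) c + count_before c S w"
  using assms by (induction a) (auto simp: count_before_append)

lemma split_run:
  obtains n s where "w = replicate n x @ s" and "s = [] \<or> (\<exists>z r. s = z # r \<and> z \<noteq> x)"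
proof -
  have "\<exists>n s. w = replicate n x @ s \<and> (s = [] \<or> (\<exists>z r. s = z # r \<and> z \<noteq> x))"
  proof (induction w)
    case (Cons y w)
    then obtain n s where *: "w = replicate n x @ s" "s = [] \<or> (\<exists>z r. s = z # r \<and> z \<noteq> x)" by blast
    show ?case
    proof (cases "y = x")
      case True
      then have "y # w = replicate (Suc n) x @ s" using * by simp
      then show ?thesis using *(2) by blast
    next
      case False
      then have "y # w = replicate 0 x @ y # w" by simp
      then show ?thesis using False by blast
    qed
  qed auto
  then show thesis using that by blast
qed

lemma left_equivalent_retain:
  fixes u :: "'x::infinite variable list"
  assumes "left_equivalent u v"
  shows "set (retain v x y) = set (retain u x y)"
  using mset_eq_setD[OF mset_retain_cong[OF left_equivalent_mset[OF assms]]] by simp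

lemma left_equivalent_cond_I:
  fixes u :: "'x::infinite variable list"
  assumes eq: "left_equivalent u v" and xy: "x \<noteq> y" "star x \<noteq> y"
    and U: "retain u x y = replicate \<alpha> x @ star x # r"
  shows "\<exists>r. retain v x y = replicate \<alpha> x @ star x # r"
proof -
  obtain n s where V: "retain v x y = replicate n x @ s" "s = [] \<or> (\<exists>z r. s = z # r \<and> z \<noteq> x)"
    by (rule split_run)
  have sets: "set (retain v x y) = set (retain u x y)" by (rule left_equivalent_retain[OF eq])
  then have "star x \<in> set (retain v x y)" using U by simp
  then obtain z t where s: "s = z # t" "z \<noteq> x" using V by (auto split: if_splits)
  then have "z \<in> set (retain v x y)" using V by simp
  then have z: "z = star x \<or> z = y \<or> z = star y" using s(2) by (auto simp: set_retain var_pair_def)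
  \<comment> \<open>Here \<open>star x\<close> becomes 3 and \<open>y\<close>, \<open>star y\<close>
    become 2. The leading 1s give \<open>n = \<alpha>\<close>; a 2 before the first 3 would betray
    \<open>y\<close> or \<open>star y\<close> in place of \<open>star x\<close>.\<close>
  obtain W where W: "W x = [1]" "W (star x) = word_sharp 3 [1]" "W y = [2]"
    "W (star y) = word_sharp 3 [2]"
    "left_data (concat (map W (retain u x y))) = left_data (concat (map W (retain v x y)))"
    using left_equivalent_probe[OF eq xy, of "[1]" "[2]"] by auto
  have "n = \<alpha> \<and> z = star x"
    using z W(5) xy unfolding U V(1) s(1)
    by (elim disjE) (auto simp: W(1-4) word_sharp_def left_data_def)
  then show ?thesis using V s by auto
qed

lemma left_equivalent_cond_II:
  fixes u :: "'x::infinite variable list"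
  assumes eq: "left_equivalent u v" and xy: "x \<noteq> y" "star x \<noteq> y"
    and U: "retain u x y = replicate \<alpha> y @ x # r"
  shows "\<exists>r. retain v x y = replicate \<alpha> y @ x # r"
proof -
  obtain n s where V: "retain v x y = replicate n y @ s" "s = [] \<or> (\<exists>z r. s = z # r \<and> z \<noteq> y)"
    by (rule split_run)
  have sets: "set (retain v x y) = set (retain u x y)" by (rule left_equivalent_retain[OF eq])
  then have "x \<in> set (retain v x y)" using U by simp
  then obtain z t where s: "s = z # t" "z \<noteq> y" using V xy by (auto split: if_splits)
  then have "z \<in> set (retain v x y)" using V by simp
  then have z: "z = x \<or> z = star x \<or> z = star y" using s(2) by (auto simp: set_retain var_pair_def)
  \<comment> \<open>The leading 1s give \<open>n = \<alpha>\<close>, and a 2 before the first 3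
    excludes \<open>star y\<close>, whose value is 3. Since 2 is fixed by the involution,
    \<open>x\<close> and \<open>star x\<close> still look alike.\<close>
  obtain W where W: "W x = [2]" "W (star x) = word_sharp 3 [2]" "W y = [1]"
    "W (star y) = word_sharp 3 [1]"
    "left_data (concat (map W (retain u x y))) = left_data (concat (map W (retain v x y)))"
    using left_equivalent_probe[OF eq xy, of "[2]" "[1]"] by auto
  have n: "n = \<alpha>" and z': "z = x \<or> z = star x"
    using z W(5) xy unfolding U V(1) s(1)
    by (auto simp: W(1-4) word_sharp_def left_data_def)
  \<comment> \<open>The images 12 of \<open>x\<close> and 23 of \<open>star x\<close> differ in a
    leading 1.\<close>
  obtain W where W: "W x = [1, 2]" "W (star x) = word_sharp 3 [1, 2]" "W y = [1]"
    "W (star y) = word_sharp 3 [1]"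
    "left_data (concat (map W (retain u x y))) = left_data (concat (map W (retain v x y)))"
    using left_equivalent_probe[OF eq xy, of "[1, 2]" "[1]"] by auto
  have "z = x"
    using z' W(5) n unfolding U V(1) s(1)
    by (auto simp: W(1-4) word_sharp_def left_data_def)
  then show ?thesis using V s n by auto
qed

lemma split_first_outside:
  assumes "w = a @ b # r" and "set a \<subseteq> A" and "b \<notin> A" and "set w' = set w"
  obtains a' z r' where "w' = a' @ z # r'" and "set a' \<subseteq> A" and "z \<notin> A" and "z \<in> set w"
proof -
  have "\<exists>z\<in>set w'. z \<notin> A" using assms by auto
  then obtain a' z r' where "w' = a' @ z # r'" "z \<notin> A" "\<forall>y\<in>set a'. \<not> y \<notin> A"
    by (rule split_list_first_propE)
  then show thesis using that[of a' z r'] assms(4) by auto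
qed

lemma mset_eq_if_counts_two:
  assumes "set a \<subseteq> {p, q}" and "set a' \<subseteq> {p, q}" and "occ p a = occ p a'" and "occ q a = occ q a'"
  shows "mset a = mset a'"
  unfolding mset_eq_iff_count_list
proof
  fix z
  show "occ z a = occ z a'"
  proof (cases "z \<in> {p, q}")
    case False
    then have "z \<notin> set a" "z \<notin> set a'" using assms by auto
    then show ?thesis by (simp add: count_list_0_iff[THEN iffD2])
  qed (use assms in auto)
qed

lemma left_equivalent_cond_III:
  fixes u :: "'x::infinite variable list"
  assumes eq: "left_equivalent u v" and xy: "x \<noteq> y" "star x \<noteq> y"
    and a: "con a = {star x, star y}" and U: "retain u x y = a @ x # r"
  shows "\<exists>a' r. mset a' = mset a \<and> retain v x y = a' @ x # r"
proof -
  have yx: "y \<noteq> star x" "x \<noteq> star y" "star y \<noteq> x" using xy by auto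
  have sets: "set (retain v x y) = set (retain u x y)" by (rule left_equivalent_retain[OF eq])
  obtain a' z r' where V: "retain v x y = a' @ z # r'" "con a' \<subseteq> {star x, star y}"
      "z \<notin> {star x, star y}" "z \<in> set (retain u x y)"
    using split_first_outside[OF U equalityD1[OF a] _ sets] xy yx by auto
  have z: "z = x \<or> z = y" using V(3,4) by (auto simp: set_retain var_pair_def)
  have ne: "star x \<noteq> star y" using xy by simp
  note two = count_before_two[OF equalityD1[OF a] ne] count_before_two[OF V(2) ne]
  \<comment> \<open>Both starred variables become 1, so the leading 1s give the length of the block.
    The next assignment doubles the weight of \<open>star y\<close>; the two equations determine
    both numbers.\<close>
  obtain W where W: "W x = [3]" "W (star x) = word_sharp 3 [3]" "W y = [3]"
    "W (star y) = word_sharp 3 [3]"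
    "left_data (concat (map W (retain u x y))) = left_data (concat (map W (retain v x y)))"
    using left_equivalent_probe[OF eq xy, of "[3]" "[3]"] by auto
  have sum1: "occ (star x) a + occ (star y) a = occ (star x) a' + occ (star y) a'"
    using z W(5) unfolding U V(1)
    by (auto simp: W(1-4) word_sharp_def left_data_def two)
  obtain W where W: "W x = [3]" "W (star x) = word_sharp 3 [3]" "W y = [3, 3]"
    "W (star y) = word_sharp 3 [3, 3]"
    "left_data (concat (map W (retain u x y))) = left_data (concat (map W (retain v x y)))"
    using left_equivalent_probe[OF eq xy, of "[3]" "[3, 3]"] by auto
  have sum2: "occ (star x) a + occ (star y) a * 2 = occ (star x) a' + occ (star y) a' * 2"
    using z W(5) unfolding U V(1)
    by (auto simp: W(1-4) word_sharp_def left_data_def two)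
  \<comment> \<open>The image 112 of \<open>star x\<close> has no 3, while \<open>x\<close> brings a
    2 ahead of its 3s. Hence the number of 2s before the first 3 is one larger for
    \<open>z = x\<close> than for \<open>z = y\<close>.\<close>
  obtain W where W: "W x = [2, 3, 3]" "W (star x) = word_sharp 3 [2, 3, 3]" "W y = [3]"
    "W (star y) = word_sharp 3 [3]"
    "left_data (concat (map W (retain u x y))) = left_data (concat (map W (retain v x y)))"
    using left_equivalent_probe[OF eq xy, of "[2, 3, 3]" "[3]"] by auto
  have "z = x"
    using z W(5) sum1 sum2 unfolding U V(1)
    by (auto simp: W(1-4) word_sharp_def left_data_def two)
  moreover have "mset a' = mset a"
    using mset_eq_if_counts_two[OF V(2) equalityD1[OF a]] sum1 sum2 by simp
  ultimately show ?thesis using V(1) by auto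
qed

lemma left_equivalent_cond_IV:
  fixes u :: "'x::infinite variable list"
  assumes eq: "left_equivalent u v" and xy: "x \<noteq> y" "star x \<noteq> y"
  shows "occ_before_first y x u + occ_before_first y (star x) u
    = occ_before_first y x v + occ_before_first y (star x) v"
proof -
  obtain W where W: "W x = [2]" "W (star x) = word_sharp 3 [2]" "W y = [3]"
    "W (star y) = word_sharp 3 [3]" "\<forall>z. z \<notin> var_pair x y \<longrightarrow> W z = []"
    "left_data (concat (map W (retain u x y))) = left_data (concat (map W (retain v x y)))"
    using left_equivalent_probe[OF eq xy, of "[2]" "[3]"] by auto
  have "count_before 2 {3} (concat (map W w))
    = occ_before_first y x w + occ_before_first y (star x) w" for w
  proof (induction w)
    case (Cons z w)
    consider "z = x" | "z = star x" | "z = y" | "z = star y" "z \<noteq> x" "z \<noteq> star x" "z \<noteq> y"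
      | "z \<notin> var_pair x y"
      unfolding var_pair_def by blast
    then show ?case
      using Cons xy W
      by cases (auto simp: occ_before_first_def word_sharp_def var_pair_def)
  qed (simp add: occ_before_first_def)
  then show ?thesis
    using W(6) by (simp add: left_data_def concat_map_retain[OF W(5)])
qed

lemma left_equivalent_cond_V:
  fixes u :: "'x::infinite variable list"
  assumes eq: "left_equivalent u v" and xy: "x \<noteq> y" "star x \<noteq> y"
    and a: "con a = {x, star x}" and U: "retain u x y = a @ y # r"
  shows "\<exists>a' r. mset a' = mset a \<and> retain v x y = a' @ y # r"
proof -
  have yx: "y \<noteq> star x" "y \<noteq> x" "x \<noteq> star x" using xy by auto
  have sets: "set (retain v x y) = set (retain u x y)" by (rule left_equivalent_retain[OF eq])
  obtain a' z r' where V: "retain v x y = a' @ z # r'" "con a' \<subseteq> {x, star x}"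
      "z \<notin> {x, star x}" "z \<in> set (retain u x y)"
    using split_first_outside[OF U equalityD1[OF a] _ sets] yx by auto
  have z: "z = y \<or> z = star y" using V(3,4) by (auto simp: set_retain var_pair_def)
  note two = count_before_two[OF equalityD1[OF a] yx(3)] count_before_two[OF V(2) yx(3)]
  \<comment> \<open>With \<open>x\<close> erased, the retained words start with 12 for
    \<open>y\<close> or with 23 for \<open>star y\<close>.\<close>
  obtain W where W: "W x = []" "W (star x) = word_sharp 3 []" "W y = [1, 2]"
    "W (star y) = word_sharp 3 [1, 2]"
    "left_data (concat (map W (retain u x y))) = left_data (concat (map W (retain v x y)))"
    using left_equivalent_probe[OF eq xy, of "[]" "[1, 2]"] by auto
  have "z = y"
    using z W(5) unfolding U V(1)
    by (auto simp: W(1-4) word_sharp_def left_data_def two)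
  \<comment> \<open>Both \<open>y\<close> and \<open>star y\<close> become the stopping letter 2;
    the 1s before it count \<open>x\<close> here and \<open>star x\<close> in the next
    assignment.\<close>
  obtain W where W: "W x = [1]" "W (star x) = word_sharp 3 [1]" "W y = [2]"
    "W (star y) = word_sharp 3 [2]"
    "left_data (concat (map W (retain u x y))) = left_data (concat (map W (retain v x y)))"
    using left_equivalent_probe[OF eq xy, of "[1]" "[2]"] by auto
  have "occ x a = occ x a'"
    using z W(5) unfolding U V(1)
    by (auto simp: W(1-4) word_sharp_def left_data_def two)
  moreover obtain W where W: "W x = [3]" "W (star x) = word_sharp 3 [3]" "W y = [2]"
    "W (star y) = word_sharp 3 [2]"
    "left_data (concat (map W (retain u x y))) = left_data (concat (map W (retain v x y)))"
    using left_equivalent_probe[OF eq xy, of "[3]" "[2]"] by auto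
  have "occ (star x) a = occ (star x) a'"
    using z W(5) unfolding U V(1)
    by (auto simp: W(1-4) word_sharp_def left_data_def two)
  ultimately have "mset a' = mset a"
    using mset_eq_if_counts_two[OF V(2) equalityD1[OF a]] by simp
  then show ?thesis using V(1) \<open>z = y\<close> by auto
qed

lemma left_equivalent_iff:
  fixes u :: "'x::infinite variable list"
  shows "left_equivalent u v \<longleftrightarrow> mset u = mset v \<and> left_conditions u v"
proof
  assume eq: "left_equivalent u v"
  have "left_conditions u v"
    unfolding left_conditions_def
  proof (intro ballI allI impI conjI, goal_cases)
    case (1 x y \<alpha>)
    then show ?case using left_equivalent_cond_I[OF eq, of x y \<alpha>] by blast
  next
    case (2 x y \<alpha>)
    then show ?case using left_equivalent_cond_II[OF eq, of x y \<alpha>] by blast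
  next
    case (3 x y a)
    then show ?case using left_equivalent_cond_III[OF eq, of x y a] by blast
  next
    case (4 x y)
    then show ?case using left_equivalent_cond_IV[OF eq, of x y] by blast
  next
    case (5 x y a)
    then show ?case using left_equivalent_cond_V[OF eq, of x y a] by blast
  qed
  then show "mset u = mset v \<and> left_conditions u v"
    using left_equivalent_mset[OF eq] by blast
qed (use left_equivalentI in blast)

section \<open>Reversal and the parts (b)\<close>

lemma retain_in_prefix_iff:
  "retain u x y \<in> {p @ [z]} \<cdot> lists (var_pair x y) \<longleftrightarrow> (\<exists>r. retain u x y = p @ z # r)"
proof
  assume "\<exists>r. retain u x y = p @ z # r"
  then obtain r where r: "retain u x y = p @ z # r" by blast
  have "set r \<subseteq> set (retain u x y)" using r by auto
  then have "r \<in> lists (var_pair x y)" by (auto simp: set_retain)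
  then show "retain u x y \<in> {p @ [z]} \<cdot> lists (var_pair x y)"
    using r by (auto simp: conc_def)
qed (auto simp: conc_def)

lemma retain_rev: "retain (rev u) x y = rev (retain u x y)"
  by (simp add: retain_def rev_filter)

lemma retain_in_suffix_iff:
  "retain u x y \<in> lists (var_pair x y) \<cdot> {[z] @ p} \<longleftrightarrow> (\<exists>r. retain (rev u) x y = rev p @ z # r)"
proof -
  have "retain u x y \<in> lists (var_pair x y) \<cdot> {[z] @ p} \<longleftrightarrow>
    retain (rev u) x y \<in> {rev p @ [z]} \<cdot> lists (var_pair x y)"
  proof
    assume "retain u x y \<in> lists (var_pair x y) \<cdot> {[z] @ p}"
    then obtain r where "r \<in> lists (var_pair x y)" "retain u x y = r @ z # p"
      by (auto simp: conc_def)
    then show "retain (rev u) x y \<in> {rev p @ [z]} \<cdot> lists (var_pair x y)"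
      unfolding conc_def by (auto simp: retain_rev intro!: exI[of _ "rev r"])
  next
    assume "retain (rev u) x y \<in> {rev p @ [z]} \<cdot> lists (var_pair x y)"
    then obtain r where r: "r \<in> lists (var_pair x y)" "rev (retain u x y) = rev p @ z # r"
      by (auto simp: conc_def retain_rev)
    from r(2) have "retain u x y = rev r @ z # p" by (simp add: rev_swap)
    with r(1) show "retain u x y \<in> lists (var_pair x y) \<cdot> {[z] @ p}"
      unfolding conc_def by (auto intro!: exI[of _ "rev r"])
  qed
  then show ?thesis by (simp only: retain_in_prefix_iff)
qed

lemma balanced_iff: "balanced u v \<longleftrightarrow> mset u = mset v"
proof
  assume *: "balanced u v"
  show "mset u = mset v"
    unfolding mset_eq_iff_count_list
  proof
    fix z
    show "occ z u = occ z v"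
      using * by (cases "z \<in> con (u @ v)") (auto simp: balanced_def)
  qed
qed (simp add: balanced_def mset_eq_iff_count_list)

lemma permutation_of_iff: "permutation_of a' a \<longleftrightarrow> mset a' = mset a"
  by (auto simp: permutation_of_def mset_eq_iff_count_list)

lemma all_rev: "(\<forall>a. P (rev a)) \<longleftrightarrow> (\<forall>a. P a)"
  by (metis rev_rev_ident)

lemma ex_rev: "(\<exists>a. P (rev a)) \<longleftrightarrow> (\<exists>a. P a)"
  by (metis rev_rev_ident)

text \<open>Reversal preserves content and multiplicities, so a quantified block may be replaced by
  its reverse.\<close>

lemma suffix_perm_iff:
  "(\<forall>a. con a = A \<and> (\<exists>r. U = rev a @ z # r) \<longrightarrow> (\<exists>a'. mset a' = mset a \<and> (\<exists>r. V = rev a' @ z # r)))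
   \<longleftrightarrow> (\<forall>a. con a = A \<and> (\<exists>r. U = a @ z # r) \<longrightarrow> (\<exists>a' r. mset a' = mset a \<and> V = a' @ z # r))"
  using all_rev[of "\<lambda>a. con a = A \<and> (\<exists>r. U = a @ z # r) \<longrightarrow> (\<exists>a' r. mset a' = mset a \<and> V = a' @ z # r)"]
    ex_rev[of "\<lambda>a'. mset a' = mset a \<and> (\<exists>r. V = a' @ z # r)" for a]
  by simp

text \<open>The parts (a) and (b) share their guards, so the conjunction splits into
  \<open>left_conditions\<close> for the words and for their reverses.\<close>

lemma split_conditions:
  "(\<forall>x\<in>A. \<forall>y. P x y \<longrightarrow> a1 x y \<and> b1 x y \<and> (Q y \<longrightarrow>
      a2 x y \<and> b2 x y \<and> a3 x y \<and> b3 x y \<and> a4 x y \<and> b4 x y \<and> a5 x y \<and> b5 x y)) \<longleftrightarrow>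
   (\<forall>x\<in>A. \<forall>y. P x y \<longrightarrow> a1 x y \<and> (Q y \<longrightarrow> a2 x y \<and> a3 x y \<and> a4 x y \<and> a5 x y)) \<and>
   (\<forall>x\<in>A. \<forall>y. P x y \<longrightarrow> b1 x y \<and> (Q y \<longrightarrow> b2 x y \<and> b3 x y \<and> b4 x y \<and> b5 x y))"
  by fast

theorem theorem4p3:
  fixes u v :: "'x::{countable, infinite} variable list"
  assumes "u \<noteq> []" and "v \<noteq> []"
  shows "identity_holds (baxt 3) (sharp 3) u v \<longleftrightarrow>
    balanced u v \<and>
    (\<forall>x \<in> con u. \<forall>y. x \<noteq> y \<and> star x \<noteq> y \<longrightarrow>
      (let Z = var_pair x y in
        \<comment> \<open>(I)\<close>
        (\<forall>\<alpha>\<ge>1. retain u x y \<in> {replicate \<alpha> x @ [star x]} \<cdot> lists Z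
            \<longrightarrow> retain v x y \<in> {replicate \<alpha> x @ [star x]} \<cdot> lists Z) \<and>
        (\<forall>\<alpha>\<ge>1. retain u x y \<in> lists Z \<cdot> {[star x] @ replicate \<alpha> x}
            \<longrightarrow> retain v x y \<in> lists Z \<cdot> {[star x] @ replicate \<alpha> x}) \<and>
        (y \<in> con u \<longrightarrow>
          \<comment> \<open>(II)\<close>
          (\<forall>\<alpha>\<ge>1. retain u x y \<in> {replicate \<alpha> y @ [x]} \<cdot> lists Z
              \<longrightarrow> retain v x y \<in> {replicate \<alpha> y @ [x]} \<cdot> lists Z) \<and>
          (\<forall>\<alpha>\<ge>1. retain u x y \<in> lists Z \<cdot> {[x] @ replicate \<alpha> y}
              \<longrightarrow> retain v x y \<in> lists Z \<cdot> {[x] @ replicate \<alpha> y}) \<and>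
          \<comment> \<open>(III)\<close>
          (\<forall>a. con a = {star x, star y} \<and> retain u x y \<in> {a @ [x]} \<cdot> lists Z
              \<longrightarrow> (\<exists>a'. permutation_of a' a \<and> retain v x y \<in> {a' @ [x]} \<cdot> lists Z)) \<and>
          (\<forall>a. con a = {star x, star y} \<and> retain u x y \<in> lists Z \<cdot> {[x] @ a}
              \<longrightarrow> (\<exists>a'. permutation_of a' a \<and> retain v x y \<in> lists Z \<cdot> {[x] @ a'})) \<and>
          \<comment> \<open>(IV)\<close>
          occ_before_first y x u + occ_before_first y (star x) u
            = occ_before_first y x v + occ_before_first y (star x) v \<and>
          occ_after_last y x u + occ_after_last y (star x) u
            = occ_after_last y x v + occ_after_last y (star x) v \<and>
          \<comment> \<open>(V)\<close>
          (\<forall>a. con a = {x, star x} \<and> retain u x y \<in> {a @ [y]} \<cdot> lists Z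
              \<longrightarrow> (\<exists>a'. permutation_of a' a \<and> retain v x y \<in> {a' @ [y]} \<cdot> lists Z)) \<and>
          (\<forall>a. con a = {x, star x} \<and> retain u x y \<in> lists Z \<cdot> {[y] @ a}
              \<longrightarrow> (\<exists>a'. permutation_of a' a \<and> retain v x y \<in> lists Z \<cdot> {[y] @ a'})))))"
    (is "_ \<longleftrightarrow> _ \<and> ?C")
proof -
  have after: "occ_after_last y x w = occ_before_first y x (rev w)" for x y and w :: "'x variable list"
    by (simp add: occ_after_last_def occ_before_first_def)
  have "?C \<longleftrightarrow> left_conditions u v \<and> left_conditions (rev u) (rev v)"
    unfolding left_conditions_def Let_def retain_in_prefix_iff retain_in_suffix_iff
      permutation_of_iff after rev_replicate suffix_perm_iff set_rev ex_simps(2)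
    by (rule split_conditions)
  then show ?thesis
    by (auto simp: identity_holds_iff_left_equivalent left_equivalent_iff balanced_iff)
qed

end
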